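(* Let $n\ge 3$, $\lambda>0$, $\gamma>0$, $\delta\in(0,1)$, and let $\ell:\mathbb R\to\mathbb R$ be $L$-Lipschitz. Let $(p_t)_{t\in\mathcal T}$ be arbitrary numbers in $[0,1]$, and let $\mathcal S=((t_1,y_1),\dots,(t_m,y_m))$ be a sample of $m=|\mathcal S|$ i.i.d. pairs, where each $t_s$ is uniform on $\mathcal T$ and, conditionally on $t_s$, $y_s\in\{-1,1\}$ with $\mathbb P(y_s=-1\mid t_s)=p_{t_s}$. Let $G^\star\in\mathcal G_{\lambda,\gamma}$ be arbitrary (in the paper, the Gram matrix of the latent points) and let $\widehat G$ be any minimizer of $\widehat R_{\mathcal S}$ over $\mathcal G_{\lambda,\gamma}$. Then with probability at least $1-\delta$, $$R(\widehat G)-R(G^\star)\le \frac{4L\lambda}{m}\left(\sqrt{\frac{18\, m\log n}{n}}+\frac{\sqrt3}{3}\log n\right)+L\gamma\sqrt{\frac{288\log(2/\delta)}{m}}.$$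
   Context: Let $\mathcal T=\{(i,j,k): i,j,k\in\{1,\dots,n\}\text{ pairwise distinct},\ j<k\}$, so $|\mathcal T|=n\binom{n-1}{2}$. For $t=(i,j,k)\in\mathcal T$ let $L_t$ be the symmetric $n\times n$ matrix with $(L_t)_{jj}=1$, $(L_t)_{kk}=-1$, $(L_t)_{ij}=(L_t)_{ji}=-1$, $(L_t)_{ik}=(L_t)_{ki}=1$ and all other entries $0$; thus $\langle L_t,G\rangle:=\mathrm{tr}(L_tG)=G_{jj}-2G_{ij}-G_{kk}+2G_{ik}$. Let $\mathbb S^n_+$ be the set of $n\times n$ symmetric positive semidefinite matrices, $\|G\|_*$ the nuclear norm, $\|G\|_\infty=\max_{ij}|G_{ij}|$, and $\mathcal G_{\lambda,\gamma}=\{G\in\mathbb S^n_+:\|G\|_*\le\lambda,\ \|G\|_\infty\le\gamma\}$. The risk is $R(G)=\frac1{|\mathcal T|}\sum_{t\in\mathcal T}\big[p_t\,\ell(-\langle L_t,G\rangle)+(1-p_t)\,\ell(\langle L_t,G\rangle)\big]$ and the empirical risk is $\widehat R_{\mathcal S}(G)=\frac1m\sum_{s=1}^m\ell(y_s\langle L_{t_s},G\rangle)$. $\log$ is the natural logarithm. *)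

theory Defs
  imports "HOL-Analysis.Analysis" "HOL-Probability.Probability"
begin

text \<open>Index set {1..n} is modelled by a finite linearly ordered type 'n, n = CARD('n).
  Matrices are real^'n^'n.\<close>

type_synonym 'n triple = "'n \<times> 'n \<times> 'n"

definition triples :: "('n::{finite,linorder}) triple set" where
  "triples = {(i,j,k). i \<noteq> j \<and> i \<noteq> k \<and> j \<noteq> k \<and> j < k}"

definition Lmat :: "('n::finite) triple \<Rightarrow> real^'n^'n" where
  "Lmat t = (case t of (i,j,k) \<Rightarrow>
     (\<chi> a b. (if a = j \<and> b = j then 1 else 0) + (if a = k \<and> b = k then -1 else 0)
            + (if (a = i \<and> b = j) \<or> (a = j \<and> b = i) then -1 else 0)
            + (if (a = i \<and> b = k) \<or> (a = k \<and> b = i) then 1 else 0)))"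

definition frob_inner :: "real^'n^'n \<Rightarrow> real^'n^'n \<Rightarrow> real" where
  "frob_inner A B = trace (A ** B)"

definition psd :: "real^('n::finite)^'n \<Rightarrow> bool" where
  "psd G \<longleftrightarrow> transpose G = G \<and> (\<forall>x. 0 \<le> x \<bullet> (G *v x))"

text \<open>Nuclear norm: trace of the PSD square root of G^T G (sum of singular values).\<close>
definition nuclear_norm :: "real^('n::finite)^'n \<Rightarrow> real" where
  "nuclear_norm G = trace (THE S. psd S \<and> S ** S = transpose G ** G)"

definition max_norm :: "real^('n::finite)^'n \<Rightarrow> real" where
  "max_norm G = Max {\<bar>G $ a $ b\<bar> | a b. True}"

definition Gset :: "real \<Rightarrow> real \<Rightarrow> (real^('n::finite)^'n) set" where
  "Gset lam gam = {G. psd G \<and> nuclear_norm G \<le> lam \<and> max_norm G \<le> gam}"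

definition risk :: "(real \<Rightarrow> real) \<Rightarrow> (('n::{finite,linorder}) triple \<Rightarrow> real) \<Rightarrow> real^('n::{finite,linorder})^('n::{finite,linorder}) \<Rightarrow> real" where
  "risk l p G = (let T = triples in (1 / real (card T)) *
     (\<Sum>t\<in>T. p t * l (- frob_inner (Lmat t) G) + (1 - p t) * l (frob_inner (Lmat t) G)))"

definition emp_risk :: "(real \<Rightarrow> real) \<Rightarrow> (('n::finite) triple \<times> real) list \<Rightarrow> real^'n^'n \<Rightarrow> real" where
  "emp_risk l S G = (1 / real (length S)) *
     sum_list (map (\<lambda>(t,y). l (y * frob_inner (Lmat t) G)) S)"

definition pair_dist :: "(('n::{finite,linorder}) triple \<Rightarrow> real) \<Rightarrow> ('n triple \<times> real) pmf" where
  "pair_dist p = do { t \<leftarrow> pmf_of_set triples;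
                      b \<leftarrow> bernoulli_pmf (p t);
                      return_pmf (t, if b then -1 else 1) }"

definition sample_dist :: "nat \<Rightarrow> (('n::{finite,linorder}) triple \<Rightarrow> real) \<Rightarrow> ('n triple \<times> real) list pmf" where
  "sample_dist m p = replicate_pmf m (pair_dist p)"

end

theory Submission
  imports Defs
begin

text \<open>
  Since the empirical minimizer has empirical risk at most that of \<open>G\<^sup>*\<close>, the excess risk is at most
  \<open>\<Phi>/m\<close>, where \<open>\<Phi>\<close> is the supremum over \<open>G\<close> of the sum over the sample of the centred losses
  \<open>\<mu>(G) - h\<^sub>G(z)\<close>, \<open>h\<^sub>G\<close> being the loss of \<open>G\<close> minus that of \<open>G\<^sup>*\<close>. As \<open>\<bar>h\<^sub>G\<bar> \<le> 12 L \<gamma>\<close>,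
  McDiarmid's inequality bounds the deviation of \<open>\<Phi>\<close> from its mean. The mean is bounded by replacing
  the sample points one at a time: symmetrization and contraction turn a centred loss into
  \<open>2 L \<epsilon> \<langle>L\<^sub>t, G\<rangle>\<close> with a random sign \<open>\<epsilon>\<close>, and the supremum of \<open>\<langle>A, G\<rangle>\<close> over positive semidefinite
  \<open>G\<close> of trace at most \<open>\<lambda>\<close> is at most \<open>\<lambda>/\<theta>\<close> times the potential \<open>ln (tr (exp (\<theta>A)))\<close> when \<open>tr A = 0\<close>.
  By the Golden--Thompson inequality, adding a random \<open>\<epsilon> L\<^sub>t\<close> to \<open>A\<close> raises the potential by at most
  \<open>9\<theta>\<^sup>2/n\<close> on average for \<open>\<theta>\<^sup>2 \<le> 3/4\<close>, because the nonzero eigenvalues of \<open>L\<^sub>t\<close> are \<open>\<plusminus>\<surd>3\<close> and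
  \<open>L\<^sub>t\<^sup>2\<close> is at most three times the projection onto the coordinates \<open>i, j, k\<close>. Optimizing \<open>\<theta>\<close> finishes the proof.
\<close>

section \<open>Spectral theorem, trace inequalities and the Golden--Thompson inequality\<close>

lemma symmetric_inner_swap:
  fixes A :: "real^'n^'n"
  assumes "transpose A = A"
  shows "x \<bullet> (A *v y) = (A *v x) \<bullet> y"
  using dot_lmul_matrix[of x A y] transpose_matrix_vector[of A x] assms by simp

text \<open>First-order condition for perturbation arguments: for small \<open>t\<close> of the sign
  of \<open>a\<close> the linear term dominates. The proof takes \<open>t = a / c\<close> with some
  \<open>c > 0\<close> that is at least \<open>b\<close>.\<close>

lemma linear_le_quadratic_imp_zero:
  fixes a b :: real
  assumes "\<And>t. 2 * t * a \<le> t\<^sup>2 * b"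
  shows "a = 0"
proof (rule ccontr)
  assume "a \<noteq> 0"
  define c where "c = \<bar>b\<bar> + 1"
  have c: "c > 0" "b \<le> c" by (auto simp: c_def)
  have "2 * (a / c) * a \<le> (a / c)\<^sup>2 * b" by (rule assms)
  also have "\<dots> \<le> (a / c)\<^sup>2 * c" using c by (intro mult_left_mono) auto
  also have "\<dots> = a\<^sup>2 / c" using c by (simp add: power2_eq_square)
  finally have "a\<^sup>2 / c \<le> 0" using c by (simp add: power2_eq_square)
  then show False using \<open>a \<noteq> 0\<close> c by (simp add: divide_le_0_iff)
qed

text \<open>A maximiser of the Rayleigh quotient on an invariant subspace is an eigenvector.\<close>
lemma symmetric_invariant_subspace_eigenvector:
  fixes A :: "real^'n^'n"
  assumes sym: "transpose A = A" and V: "subspace V" and inv: "\<And>x. x \<in> V \<Longrightarrow> A *v x \<in> V"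
    and ne: "x0 \<in> V" "x0 \<noteq> 0"
  obtains v d where "v \<in> V" "norm v = 1" "A *v v = d *\<^sub>R v"
proof -
  define K where "K = V \<inter> sphere 0 1"
  have "compact K"
    unfolding K_def using closed_subspace[OF V] by (intro closed_Int_compact) auto
  moreover have "x0 /\<^sub>R norm x0 \<in> K"
    using ne V by (auto simp: K_def subspace_scale)
  moreover have "continuous_on K (\<lambda>x. x \<bullet> (A *v x))"
    by (intro continuous_intros linear_continuous_on matrix_vector_mul_bounded_linear)
  ultimately obtain v where vK: "v \<in> K" and max: "\<And>x. x \<in> K \<Longrightarrow> x \<bullet> (A *v x) \<le> v \<bullet> (A *v v)"
    using continuous_attains_sup[of K "\<lambda>x. x \<bullet> (A *v x)"] by blast
  define \<mu> where "\<mu> = v \<bullet> (A *v v)"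
  have v: "v \<in> V" "norm v = 1" using vK by (auto simp: K_def)
  have vv: "v \<bullet> v = 1" using v by (simp add: norm_eq_1)
  have ray: "x \<bullet> (A *v x) \<le> \<mu> * (x \<bullet> x)" if "x \<in> V" for x
  proof (cases "x = 0")
    case False
    have "(x /\<^sub>R norm x) \<bullet> (A *v (x /\<^sub>R norm x)) \<le> \<mu>"
      unfolding \<mu>_def using False that V by (intro max) (auto simp: K_def subspace_scale)
    then have "(x \<bullet> (A *v x)) / (norm x)\<^sup>2 \<le> \<mu>"
      by (simp add: matrix_vector_mult_scaleR divide_simps power2_eq_square)
    then show ?thesis using False
      by (simp add: divide_simps dot_square_norm)
  qed auto
  \<comment> \<open>\<open>w\<close> is the component of \<open>A *v v\<close> orthogonal to
    \<open>v\<close>. Comparing the Rayleigh quotient at \<open>v\<close> and at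
    \<open>v + t *\<^sub>R w\<close> for all \<open>t\<close> forces it to vanish.\<close>
  define w where "w = A *v v - \<mu> *\<^sub>R v"
  have wV: "w \<in> V" unfolding w_def using v V inv by (intro subspace_diff subspace_scale) auto
  have wv: "w \<bullet> v = 0"
    by (simp add: w_def inner_diff_left vv) (simp add: \<mu>_def inner_commute)
  have "2 * t * (w \<bullet> (A *v v)) \<le> t\<^sup>2 * (\<mu> * (w \<bullet> w) - w \<bullet> (A *v w))" for t
  proof -
    have "(v + t *\<^sub>R w) \<bullet> (A *v (v + t *\<^sub>R w)) \<le> \<mu> * ((v + t *\<^sub>R w) \<bullet> (v + t *\<^sub>R w))"
      using v wV V by (intro ray subspace_add subspace_scale) auto
    moreover have "v \<bullet> (A *v w) = w \<bullet> (A *v v)"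
      using symmetric_inner_swap[OF sym, of v w] by (simp add: inner_commute)
    moreover have "v \<bullet> w = 0" using wv by (simp add: inner_commute)
    ultimately show ?thesis
      using wv vv by (simp add: inner_add_left inner_add_right matrix_vector_right_distrib
          matrix_vector_mult_scaleR \<mu>_def[symmetric] power2_eq_square algebra_simps)
  qed
  then have "w \<bullet> (A *v v) = 0" by (rule linear_le_quadratic_imp_zero)
  moreover have "A *v v = w + \<mu> *\<^sub>R v" by (simp add: w_def)
  ultimately have "w \<bullet> w = 0" by (simp add: inner_add_right wv)
  then have "A *v v = \<mu> *\<^sub>R v" by (simp add: w_def)
  with v show ?thesis by (rule that)
qed

text \<open>A largest orthonormal set of eigenvectors spans: its orthogonal complement is invariant
  under \<open>A\<close>, so a nonzero complement would supply one more unit eigenvector.\<close>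

lemma symmetric_orthonormal_eigenbasis:
  fixes A :: "real^'n^'n"
  assumes sym: "transpose A = A"
  obtains B where "finite B" "card B = CARD('n)" "pairwise orthogonal B" "\<And>b. b \<in> B \<Longrightarrow> norm b = 1"
    "\<And>b. b \<in> B \<Longrightarrow> \<exists>d. A *v b = d *\<^sub>R b"
proof -
  define Q where "Q B \<longleftrightarrow> pairwise orthogonal B \<and> (\<forall>b\<in>B. norm b = 1 \<and> (\<exists>d. A *v b = d *\<^sub>R b))"
    for B :: "(real^'n) set"
  have Qi: "independent B" if "Q B" for B
    using that unfolding Q_def by (intro pairwise_orthogonal_independent) force+
  have Qc: "finite B \<and> card B \<le> CARD('n)" if "Q B" for B
    using independent_bound[OF Qi[OF that]] by simp
  have "\<exists>B. Q B \<and> (\<forall>B'. Q B' \<longrightarrow> card B' \<le> card B)"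
    by (rule ex_has_greatest_nat[of Q "{}" card "Suc CARD('n)"])
       (use Qc in \<open>auto simp: Q_def le_imp_less_Suc\<close>)
  then obtain B where B: "Q B" and Bmax: "\<And>B'. Q B' \<Longrightarrow> card B' \<le> card B" by blast
  define V where "V = {x. \<forall>b\<in>B. b \<bullet> x = 0}"
  have V: "subspace V"
    by (auto simp: V_def subspace_def inner_add_right)
  have inv: "A *v x \<in> V" if "x \<in> V" for x
  proof -
    have "b \<bullet> (A *v x) = 0" if b: "b \<in> B" for b
    proof -
      obtain d where "A *v b = d *\<^sub>R b" using B b unfolding Q_def by blast
      then show ?thesis using symmetric_inner_swap[OF sym, of b x] \<open>x \<in> V\<close> b by (simp add: V_def)
    qed
    then show ?thesis by (simp add: V_def)
  qed
  have V0: "V = {0}"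
  proof (rule ccontr)
    assume "V \<noteq> {0}"
    then obtain x0 where "x0 \<in> V" "x0 \<noteq> 0" using subspace_0[OF V] by blast
    then obtain v d where v: "v \<in> V" "norm v = 1" "A *v v = d *\<^sub>R v"
      using symmetric_invariant_subspace_eigenvector[OF sym V inv] by blast
    have "v \<notin> B" using v by (auto simp: V_def norm_eq_1)
    moreover have "Q (insert v B)"
      using B v unfolding Q_def V_def
      by (auto simp: pairwise_insert orthogonal_def inner_commute)
    ultimately show False using Bmax[of "insert v B"] Qc[OF B] by simp
  qed
  have "span B = UNIV"
  proof (rule ccontr)
    assume "span B \<noteq> UNIV"
    then obtain a where a: "a \<noteq> 0" "\<forall>x\<in>span B. a \<bullet> x = 0"
      using span_not_univ_subset_hyperplane[of B] by auto
    then have "a \<in> V" using span_base by (auto simp: V_def inner_commute)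
    then show False using V0 a by simp
  qed
  then have "dim (UNIV :: (real^'n) set) = card B"
    using indep_card_eq_dim_span[OF Qi[OF B]] by simp
  then show ?thesis
    using that[of B] B Qc[OF B] by (auto simp: Q_def)
qed

section \<open>Spectral decompositions and traces\<close>

definition diag_mat :: "('n \<Rightarrow> real) \<Rightarrow> real^'n^'n" where
  "diag_mat d = (\<chi> i j. if i = j then d i else 0)"

text \<open>Keeping \<open>P\<close> explicit lets matrices with a common eigenbasis be compared, so
  that functional calculus reduces to arithmetic on the eigenvalues \<open>d\<close>.\<close>

definition spectral :: "real^'n^'n \<Rightarrow> ('n \<Rightarrow> real) \<Rightarrow> real^'n^'n \<Rightarrow> bool" where
  "spectral P d A \<longleftrightarrow> orthogonal_matrix P \<and> A = P ** diag_mat d ** transpose P"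

lemma diag_mat_mult: "diag_mat d ** diag_mat e = diag_mat (\<lambda>i. d i * e i)"
  by (simp add: diag_mat_def matrix_matrix_mult_def vec_eq_iff if_distrib[of "\<lambda>x. x * _"]
      cong: if_cong)

lemma matrix_mult_nth: "(A ** B) $ i $ j = (\<Sum>k\<in>UNIV. A $ i $ k * B $ k $ j)"
  by (simp add: matrix_matrix_mult_def)

lemma mat_1_diag: "mat 1 = diag_mat (\<lambda>_. 1)"
  by (simp add: diag_mat_def mat_def)

lemma matrix_mult_diag_nth: "(A ** diag_mat d) $ i $ j = A $ i $ j * d j"
  by (simp add: diag_mat_def matrix_matrix_mult_def if_distrib cong: if_cong)

lemma spectral_nth:
  assumes "spectral P d A"
  shows "A $ i $ j = (\<Sum>k\<in>UNIV. P $ i $ k * d k * P $ j $ k)"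
  using assms by (simp add: spectral_def matrix_mult_nth[of _ "transpose P"]
      matrix_mult_diag_nth) (simp add: transpose_def)

lemma symmetric_spectral_decomposition:
  fixes A :: "real^'n^'n"
  assumes sym: "transpose A = A"
  obtains P d where "spectral P d A"
proof -
  obtain B where B: "finite B" "card B = CARD('n)" "pairwise orthogonal B" "\<And>b. b \<in> B \<Longrightarrow> norm b = 1"
    "\<And>b. b \<in> B \<Longrightarrow> \<exists>d. A *v b = d *\<^sub>R b"
    by (rule symmetric_orthonormal_eigenbasis[OF sym]) blast
  then obtain f where f: "bij_betw f (UNIV::'n set) B"
    using finite_same_card_bij[of "UNIV :: 'n set" B] by auto
  then have fB: "f i \<in> B" for i by (auto simp: bij_betw_def)
  then obtain d where d: "\<And>i. A *v f i = d i *\<^sub>R f i" using B(5)[OF fB] by metis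
  define P :: "real^'n^'n" where "P = (\<chi> i j. f j $ i)"
  have "orthogonal (f i) (f j)" if "i \<noteq> j" for i j
    using B(3) f fB that unfolding pairwise_def bij_betw_def inj_on_def by (metis UNIV_I)
  then have P: "orthogonal_matrix P"
    using B(4)[OF fB] by (simp add: P_def orthogonal_matrix_orthonormal_columns column_def)
  have "A ** P = P ** diag_mat d"
    using d by (simp add: vec_eq_iff matrix_mult_diag_nth)
       (simp add: P_def matrix_matrix_mult_def matrix_vector_mult_def mult.commute)
  then have "A = P ** diag_mat d ** transpose P"
    using P by (metis matrix_mul_assoc matrix_mul_rid orthogonal_matrix_def)
  with P show ?thesis using that[of P d] by (simp add: spectral_def)
qed

lemma spectral_mult:
  assumes "spectral P d A" "spectral P e B"
  shows "spectral P (\<lambda>i. d i * e i) (A ** B)"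
proof -
  have P: "transpose P ** P = mat 1" using assms by (auto simp: spectral_def orthogonal_matrix_def)
  have "A ** B = P ** diag_mat d ** (transpose P ** P) ** diag_mat e ** transpose P"
    using assms by (simp add: spectral_def matrix_mul_assoc)
  then show ?thesis using assms
    by (simp add: spectral_def P matrix_mul_assoc[symmetric]) (simp add: matrix_mul_assoc diag_mat_mult)
qed

text \<open>Covers at once the identity (\<open>c = 0\<close>), scaling (\<open>a = 0\<close>) and
  the factors \<open>I + A/N\<close> of the exponential limit.\<close>

lemma spectral_affine:
  assumes "spectral P d A"
  shows "spectral P (\<lambda>i. a + c * d i) (a *\<^sub>R mat 1 + c *\<^sub>R A)"
proof -
  have one: "spectral P (\<lambda>_. 1) (mat 1)"
    using assms by (simp add: spectral_def mat_1_diag[symmetric] orthogonal_matrix_def)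
  have "a *\<^sub>R mat 1 + c *\<^sub>R A = P ** diag_mat (\<lambda>i. a + c * d i) ** transpose P"
    unfolding vec_eq_iff
    by (simp add: spectral_nth[OF assms] spectral_nth[OF one])
       (simp add: matrix_mult_nth[of _ "transpose P"] matrix_mult_diag_nth
         sum_distrib_left sum.distrib[symmetric] algebra_simps, simp add: transpose_def mult_ac)
  then show ?thesis using assms by (simp add: spectral_def)
qed

lemma spectral_one: "spectral P d A \<Longrightarrow> spectral P (\<lambda>_. 1) (mat 1)"
  using spectral_affine[of P d A 1 0] by simp

lemma spectral_symmetric: "spectral P d A \<Longrightarrow> transpose A = A"
  by (simp add: vec_eq_iff transpose_def spectral_nth mult_ac)

lemma trace_mult_nth: "trace (A ** B) = (\<Sum>i\<in>UNIV. \<Sum>j\<in>UNIV. A $ i $ j * B $ j $ i)"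
  by (simp add: trace_def matrix_matrix_mult_def)

lemma inner_matrix_vector: "x \<bullet> (M *v y) = (\<Sum>i\<in>UNIV. \<Sum>j\<in>UNIV. x $ i * M $ i $ j * y $ j)"
  by (simp add: inner_vec_def matrix_vector_mult_def sum_distrib_left mult.assoc)

text \<open>For positive semidefinite \<open>M\<close> the quadratic forms in the columns of
  \<open>P\<close> are nonnegative weights with sum \<open>trace M\<close>; inequalities between
  eigenvalues thus carry over to traces.\<close>

lemma trace_spectral_mult:
  assumes "spectral P d A"
  shows "trace (M ** A) = (\<Sum>k\<in>UNIV. d k * (column k P \<bullet> (M *v column k P)))"
proof -
  have "trace (M ** A) = (\<Sum>i\<in>UNIV. \<Sum>j\<in>UNIV. \<Sum>k\<in>UNIV. d k * (P $ i $ k * M $ i $ j * P $ j $ k))"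
    by (simp add: trace_mult_nth spectral_nth[OF assms] sum_distrib_left mult_ac)
  also have "\<dots> = (\<Sum>i\<in>UNIV. \<Sum>k\<in>UNIV. \<Sum>j\<in>UNIV. d k * (P $ i $ k * M $ i $ j * P $ j $ k))"
    by (intro sum.cong refl sum.swap)
  also have "\<dots> = (\<Sum>k\<in>UNIV. \<Sum>i\<in>UNIV. \<Sum>j\<in>UNIV. d k * (P $ i $ k * M $ i $ j * P $ j $ k))"
    by (rule sum.swap)
  finally show ?thesis
    by (simp add: inner_matrix_vector column_def sum_distrib_left)
qed

lemma column_orthonormal: "spectral P d A \<Longrightarrow> column k P \<bullet> column k P = 1"
  by (simp add: spectral_def orthogonal_matrix_orthonormal_columns norm_eq_1)

lemma trace_spectral:
  assumes "spectral P d A"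
  shows "trace A = (\<Sum>k\<in>UNIV. d k)"
  using trace_spectral_mult[OF assms, of "mat 1"] by (simp add: column_orthonormal[OF assms])

lemma spectral_eigenvector:
  assumes "spectral P d A"
  shows "A *v column k P = d k *\<^sub>R column k P"
proof -
  have "transpose P ** P = mat 1" using assms by (auto simp: spectral_def orthogonal_matrix_def)
  then have "A ** P = P ** diag_mat d"
    using assms by (simp add: spectral_def matrix_mul_assoc[symmetric])
  then have "(A ** P) $ i $ k = (P ** diag_mat d) $ i $ k" for i by simp
  then show ?thesis
    by (simp add: vec_eq_iff matrix_mult_diag_nth)
       (simp add: column_def matrix_matrix_mult_def matrix_vector_mult_def mult.commute)
qed

lemma spectral_psd:
  assumes "spectral P d A" "\<And>k. d k \<ge> 0"
  shows "psd A"
proof -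
  have "x \<bullet> (A *v x) \<ge> 0" for x
  proof -
    have "x \<bullet> (A *v x) = (\<Sum>i\<in>UNIV. \<Sum>j\<in>UNIV. \<Sum>k\<in>UNIV. d k * (x $ i * P $ i $ k * (x $ j * P $ j $ k)))"
      by (simp add: inner_matrix_vector spectral_nth[OF assms(1)] sum_distrib_left sum_distrib_right mult_ac)
    also have "\<dots> = (\<Sum>i\<in>UNIV. \<Sum>k\<in>UNIV. \<Sum>j\<in>UNIV. d k * (x $ i * P $ i $ k * (x $ j * P $ j $ k)))"
      by (intro sum.cong refl sum.swap)
    also have "\<dots> = (\<Sum>k\<in>UNIV. \<Sum>i\<in>UNIV. \<Sum>j\<in>UNIV. d k * (x $ i * P $ i $ k * (x $ j * P $ j $ k)))"
      by (rule sum.swap)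
    also have "\<dots> = (\<Sum>k\<in>UNIV. d k * (\<Sum>i\<in>UNIV. x $ i * P $ i $ k)\<^sup>2)"
      by (simp only: power2_eq_square sum_product) (simp only: sum_distrib_left)
    also have "\<dots> \<ge> 0" using assms(2) by (intro sum_nonneg mult_nonneg_nonneg) auto
    finally show ?thesis .
  qed
  then show ?thesis using spectral_symmetric[OF assms(1)] by (simp add: psd_def)
qed


section \<open>Matrix powers and trace inequalities for exponents that are powers of two\<close>

primrec mpow :: "real^'n^'n \<Rightarrow> nat \<Rightarrow> real^'n^'n" where
  "mpow A 0 = mat 1"
| "mpow A (Suc k) = A ** mpow A k"

lemma mpow_add: "mpow A (j + k) = mpow A j ** mpow A k"
  by (induction j) (simp_all add: matrix_mul_assoc)

lemma mpow_mult2: "mpow A (2 * k) = mpow (A ** A) k"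
proof (induction k)
  case (Suc k)
  have "mpow A (2 * Suc k) = A ** (A ** mpow A (2 * k))" by simp
  then show ?case using Suc by (simp add: matrix_mul_assoc)
qed simp

lemma mpow_mult_slide: "mpow (A ** B) k ** A = A ** mpow (B ** A) k"
  by (induction k) (simp_all add: matrix_mul_assoc[symmetric])

lemma mpow_commute: "mpow A k ** A = A ** mpow A k"
  using mpow_mult_slide[of A "mat 1" k] by simp

lemma transpose_mpow: "transpose (mpow A k) = mpow (transpose A) k"
  by (induction k) (simp_all add: matrix_transpose_mul mpow_commute)

lemma trace_mpow_mult_commute:
  fixes A B :: "real^'n^'n"
  shows "trace (mpow (A ** B) k) = trace (mpow (B ** A) k)"
proof (cases k)
  case (Suc j)
  have "trace (mpow (A ** B) k) = trace (A ** mpow (B ** A) j ** B)"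
    by (simp add: Suc mpow_commute[symmetric]) (simp add: matrix_mul_assoc mpow_mult_slide)
  also have "\<dots> = trace (B ** (A ** mpow (B ** A) j))" by (rule trace_mul_sym)
  finally show ?thesis by (simp add: Suc matrix_mul_assoc)
qed simp

text \<open>Cauchy-Schwarz for the Frobenius inner product in its arithmetic-mean form, obtained
  entry by entry.\<close>

lemma trace_mult_le:
  fixes A B :: "real^'n^'n"
  shows "trace (A ** B) \<le> (trace (A ** transpose A) + trace (B ** transpose B)) / 2"
proof -
  have "trace (A ** B) \<le> (\<Sum>i\<in>UNIV. \<Sum>j\<in>UNIV. ((A $ i $ j)\<^sup>2 + (B $ j $ i)\<^sup>2) / 2)"
    unfolding trace_mult_nth
  proof (intro sum_mono)
    fix i j
    show "A $ i $ j * B $ j $ i \<le> ((A $ i $ j)\<^sup>2 + (B $ j $ i)\<^sup>2) / 2"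
      using sum_squares_bound[of "A $ i $ j" "B $ j $ i"] by simp
  qed
  also have "\<dots> = ((\<Sum>i\<in>UNIV. \<Sum>j\<in>UNIV. (A $ i $ j)\<^sup>2) + (\<Sum>i\<in>UNIV. \<Sum>j\<in>UNIV. (B $ j $ i)\<^sup>2)) / 2"
    by (simp only: sum.distrib sum_divide_distrib[symmetric])
  also have "(\<Sum>i\<in>UNIV. \<Sum>j\<in>UNIV. (B $ j $ i)\<^sup>2) = (\<Sum>j\<in>UNIV. \<Sum>i\<in>UNIV. (B $ j $ i)\<^sup>2)"
    by (rule sum.swap)
  finally show ?thesis
    by (simp add: trace_mult_nth transpose_def power2_eq_square)
qed

text \<open>The two families of inequalities feed each other: the first for \<open>X ** Y\<close> reduces the
  second to squares, the second for \<open>Z\<^sup>TZ\<close> and \<open>ZZ\<^sup>T\<close> reduces the first to a Cauchy-Schwarz bound.\<close>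
lemma trace_mpow_power2_le:
  fixes X Y Z :: "real^'n^'n"
  shows "trace (mpow Z (2 ^ Suc k)) \<le> trace (mpow (Z ** transpose Z) (2 ^ k))"
    and "transpose X = X \<Longrightarrow> transpose Y = Y \<Longrightarrow>
         trace (mpow (X ** Y) (2 ^ k)) \<le> trace (mpow X (2 ^ k) ** mpow Y (2 ^ k))"
proof -
  define R where "R k \<longleftrightarrow> (\<forall>Z :: real^'n^'n. trace (mpow Z (2 ^ Suc k)) \<le> trace (mpow (Z ** transpose Z) (2 ^ k)))
    \<and> (\<forall>X Y :: real^'n^'n. transpose X = X \<longrightarrow> transpose Y = Y \<longrightarrow>
         trace (mpow (X ** Y) (2 ^ k)) \<le> trace (mpow X (2 ^ k) ** mpow Y (2 ^ k)))" for k
  have "R k"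
  proof (induction k)
    case 0
    have "trace (mpow Z 2) \<le> trace (Z ** transpose Z)" for Z :: "real^'n^'n"
      using trace_mult_le[of Z Z] by (simp add: numeral_2_eq_2)
    then show ?case by (simp add: R_def)
  next
    case (Suc k)
    then have IH1: "trace (mpow Z (2 ^ Suc k)) \<le> trace (mpow (Z ** transpose Z) (2 ^ k))"
      and IH2: "transpose X = X \<Longrightarrow> transpose Y = Y \<Longrightarrow>
         trace (mpow (X ** Y) (2 ^ k)) \<le> trace (mpow X (2 ^ k) ** mpow Y (2 ^ k))" for X Y Z :: "real^'n^'n"
      by (auto simp: R_def)
    have "trace (mpow Z (2 ^ Suc (Suc k))) \<le> trace (mpow (Z ** transpose Z) (2 ^ Suc k))" for Z :: "real^'n^'n"
    proof -
      let ?P = "transpose Z ** Z" and ?Q = "Z ** transpose Z"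
      have sq: "mpow S (2 ^ k) ** transpose (mpow S (2 ^ k)) = mpow S (2 ^ Suc k)"
        if "transpose S = S" for S :: "real^'n^'n"
        by (simp add: transpose_mpow that mpow_add[symmetric] mult_2[symmetric])
      have "trace (mpow Z (2 ^ Suc (Suc k))) = trace (mpow (Z ** Z) (2 ^ Suc k))"
        using mpow_mult2[of Z "2 ^ Suc k"] by simp
      also have "\<dots> \<le> trace (mpow ((Z ** Z) ** transpose (Z ** Z)) (2 ^ k))" by (rule IH1)
      \<comment> \<open>Moving the last factor \<open>transpose Z\<close> to the front under the
        trace leaves \<open>?P ** ?Q\<close>, a product of two symmetric matrices, to which the
        second family applies.\<close>
      also have "(Z ** Z) ** transpose (Z ** Z) = (Z ** Z ** transpose Z) ** transpose Z"
        by (simp add: matrix_transpose_mul matrix_mul_assoc)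
      also have "trace (mpow \<dots> (2 ^ k)) = trace (mpow (?P ** ?Q) (2 ^ k))"
        by (subst trace_mpow_mult_commute) (simp add: matrix_mul_assoc)
      also have "\<dots> \<le> trace (mpow ?P (2 ^ k) ** mpow ?Q (2 ^ k))"
        by (rule IH2) (simp_all add: matrix_transpose_mul)
      also have "\<dots> \<le> (trace (mpow ?P (2 ^ Suc k)) + trace (mpow ?Q (2 ^ Suc k))) / 2"
        using trace_mult_le[of "mpow ?P (2 ^ k)" "mpow ?Q (2 ^ k)"] sq[of ?P] sq[of ?Q]
        by (simp add: matrix_transpose_mul)
      \<comment> \<open>The two Gram matrices of \<open>Z\<close> have powers of equal trace, so the
        mean collapses to a single term.\<close>
      also have "trace (mpow ?P (2 ^ Suc k)) = trace (mpow ?Q (2 ^ Suc k))"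
        by (rule trace_mpow_mult_commute)
      finally show ?thesis by simp
    qed
    moreover have "trace (mpow (X ** Y) (2 ^ Suc k)) \<le> trace (mpow X (2 ^ Suc k) ** mpow Y (2 ^ Suc k))"
      if "transpose X = X" "transpose Y = Y" for X Y :: "real^'n^'n"
    proof -
      have "trace (mpow (X ** Y) (2 ^ Suc k)) \<le> trace (mpow ((X ** Y) ** transpose (X ** Y)) (2 ^ k))"
        by (rule IH1)
      also have "(X ** Y) ** transpose (X ** Y) = (X ** Y ** Y) ** X"
        using that by (simp add: matrix_transpose_mul matrix_mul_assoc)
      also have "trace (mpow \<dots> (2 ^ k)) = trace (mpow ((X ** X) ** (Y ** Y)) (2 ^ k))"
        by (subst trace_mpow_mult_commute) (simp add: matrix_mul_assoc)
      also have "\<dots> \<le> trace (mpow (X ** X) (2 ^ k) ** mpow (Y ** Y) (2 ^ k))"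
        by (rule IH2) (use that in \<open>simp_all add: matrix_transpose_mul\<close>)
      also have "\<dots> = trace (mpow X (2 ^ Suc k) ** mpow Y (2 ^ Suc k))"
        using mpow_mult2[of X "2 ^ k"] mpow_mult2[of Y "2 ^ k"] by simp
      finally show ?thesis .
    qed
    ultimately show ?case unfolding R_def by blast
  qed
  then show "trace (mpow Z (2 ^ Suc k)) \<le> trace (mpow (Z ** transpose Z) (2 ^ k))"
    and "transpose X = X \<Longrightarrow> transpose Y = Y \<Longrightarrow>
         trace (mpow (X ** Y) (2 ^ k)) \<le> trace (mpow X (2 ^ k) ** mpow Y (2 ^ k))"
    unfolding R_def by blast+
qed

section \<open>The matrix exponential\<close>

text \<open>Euler's limit is used because its factors \<open>I + A/N\<close> are those multiplied in
  the Lie-Trotter argument; on a spectral decomposition it exponentiates the eigenvalues.\<close>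

definition mexp :: "real^'n^'n \<Rightarrow> real^'n^'n" where
  "mexp A = lim (\<lambda>N. mpow (mat 1 + (1 / real N) *\<^sub>R A) N)"

lemma spectral_mpow: "spectral P d A \<Longrightarrow> spectral P (\<lambda>i. d i ^ k) (mpow A k)"
  by (induction k) (auto intro: spectral_one spectral_mult)

lemma spectral_mexp_limit:
  assumes "spectral P d A"
  shows "(\<lambda>N. mpow (mat 1 + (1 / real N) *\<^sub>R A) N) \<longlonglongrightarrow> P ** diag_mat (\<lambda>i. exp (d i)) ** transpose P"
proof (intro vec_tendstoI)
  fix i j
  have "spectral P (\<lambda>k. (1 + 1 / real N * d k) ^ N) (mpow (mat 1 + (1 / real N) *\<^sub>R A) N)" for N
    using spectral_mpow[OF spectral_affine[OF assms, of 1 "1 / real N"], of N] by simp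
  then have eq: "mpow (mat 1 + (1 / real N) *\<^sub>R A) N $ i $ j
      = (\<Sum>k\<in>UNIV. P $ i $ k * (1 + d k / real N) ^ N * P $ j $ k)" for N
    by (subst spectral_nth) auto
  have "spectral P (\<lambda>i. exp (d i)) (P ** diag_mat (\<lambda>i. exp (d i)) ** transpose P)"
    using assms by (simp add: spectral_def)
  note lim = spectral_nth[OF this]
  show "(\<lambda>N. mpow (mat 1 + (1 / real N) *\<^sub>R A) N $ i $ j) \<longlonglongrightarrow>
      (P ** diag_mat (\<lambda>i. exp (d i)) ** transpose P) $ i $ j"
    unfolding eq lim by (intro tendsto_intros tendsto_exp_limit_sequentially)
qed

lemma spectral_mexp:
  assumes "spectral P d A"
  shows "spectral P (\<lambda>i. exp (d i)) (mexp A)"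
  using limI[OF spectral_mexp_limit[OF assms]] assms by (simp add: spectral_def mexp_def)

lemma mexp_LIMSEQ:
  assumes "transpose A = A"
  shows "(\<lambda>N. mpow (mat 1 + (1 / real N) *\<^sub>R A) N) \<longlonglongrightarrow> mexp A"
proof -
  obtain P d where "spectral P d A" by (rule symmetric_spectral_decomposition[OF assms])
  from spectral_mexp_limit[OF this] spectral_mexp[OF this] show ?thesis by (simp add: spectral_def)
qed

section \<open>Operator norm estimates and the Golden-Thompson inequality\<close>

lemma onorm_matrix_mult_le:
  fixes A B :: "real^'n^'n"
  shows "onorm ((*v) (A ** B)) \<le> onorm ((*v) A) * onorm ((*v) B)"
proof -
  have "(*v) (A ** B) = (*v) A \<circ> (*v) B" by (simp add: fun_eq_iff matrix_vector_mul_assoc)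
  then show ?thesis using onorm_compose[of "(*v) A" "(*v) B"] by simp
qed

lemma onorm_matrix_add_le:
  fixes A B :: "real^'n^'n"
  shows "onorm ((*v) (A + B)) \<le> onorm ((*v) A) + onorm ((*v) B)"
proof -
  have "(*v) (A + B) = (\<lambda>x. A *v x + B *v x)" by (simp add: fun_eq_iff matrix_vector_mult_add_rdistrib)
  then show ?thesis using onorm_triangle[of "(*v) A" "(*v) B"] by simp
qed

lemma onorm_matrix_scaleR:
  fixes A :: "real^'n^'n"
  shows "onorm ((*v) (c *\<^sub>R A)) = \<bar>c\<bar> * onorm ((*v) A)"
proof -
  have "(*v) (c *\<^sub>R A) = (\<lambda>x. c *\<^sub>R (A *v x))" by (simp add: fun_eq_iff scaleR_matrix_vector_assoc)
  then show ?thesis using onorm_scaleR[of "(*v) A" c] by simp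
qed

lemma onorm_mat_1: "onorm ((*v) (mat 1 :: real^'n^'n)) = 1"
proof -
  have "(*v) (mat 1 :: real^'n^'n) = (\<lambda>x. x)" by auto
  then show ?thesis by (simp add: onorm_id)
qed

lemma onorm_matrix_nonneg [simp]: "0 \<le> onorm ((*v) (A :: real^'n^'n))"
  by (simp add: onorm_pos_le)

lemma matrix_add_rdistrib: "(A + B) ** C = A ** C + B ** (C :: real^'n^'n)"
  by (simp add: vec_eq_iff matrix_mult_nth algebra_simps sum.distrib)

lemma onorm_mpow_le:
  assumes "onorm ((*v) A) \<le> K"
  shows "onorm ((*v) (mpow A k)) \<le> K ^ k"
proof (induction k)
  case (Suc k)
  have "onorm ((*v) (A ** mpow A k)) \<le> onorm ((*v) A) * onorm ((*v) (mpow A k))"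
    by (rule onorm_matrix_mult_le)
  also have "\<dots> \<le> K * K ^ k"
    using assms Suc order_trans[OF onorm_matrix_nonneg assms] by (intro mult_mono) auto
  finally show ?case by simp
qed (simp add: onorm_id)

text \<open>Telescoping: the difference of the next powers is
  \<open>U ** (mpow U k - mpow V k) + (U - V) ** mpow V k\<close>.\<close>

lemma onorm_mpow_diff_le:
  fixes U V :: "real^'n^'n"
  assumes "onorm ((*v) U) \<le> K" "onorm ((*v) V) \<le> K" "1 \<le> K"
  shows "onorm ((*v) (mpow U k - mpow V k)) \<le> real k * K ^ k * onorm ((*v) (U - V))"
proof (induction k)
  case 0
  have "(*v) (0 :: real^'n^'n) = (\<lambda>x. 0)" by (auto simp: fun_eq_iff)
  then show ?case by (simp add: onorm_zero)
next
  case (Suc k)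
  let ?e = "onorm ((*v) (U - V))"
  have "mpow U (Suc k) - mpow V (Suc k) = U ** (mpow U k - mpow V k) + (U - V) ** mpow V k"
    by (simp add: vec_eq_iff matrix_mult_nth algebra_simps sum.distrib sum_subtractf)
  then have "onorm ((*v) (mpow U (Suc k) - mpow V (Suc k)))
      \<le> onorm ((*v) U) * onorm ((*v) (mpow U k - mpow V k)) + ?e * onorm ((*v) (mpow V k))"
    using onorm_matrix_add_le[of "U ** (mpow U k - mpow V k)" "(U - V) ** mpow V k"]
      onorm_matrix_mult_le[of U "mpow U k - mpow V k"] onorm_matrix_mult_le[of "U - V" "mpow V k"]
    by simp
  also have "\<dots> \<le> K * (real k * K ^ k * ?e) + ?e * K ^ k"
    using assms Suc onorm_mpow_le[OF assms(2)] by (intro add_mono mult_mono) auto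
  \<comment> \<open>Here \<open>1 \<le> K\<close> pads \<open>K ^ k\<close> to
    \<open>K ^ Suc k\<close>, so that both summands carry the same power.\<close>
  also have "\<dots> \<le> K * (real k * K ^ k * ?e) + ?e * (K * K ^ k)"
    using assms by (intro add_left_mono mult_left_mono) (auto simp: mult_le_cancel_right1)
  also have "\<dots> = real (Suc k) * K ^ Suc k * ?e" by (simp add: algebra_simps)
  finally show ?case .
qed

lemma abs_trace_le_onorm:
  fixes A :: "real^'n^'n"
  shows "\<bar>trace A\<bar> \<le> real CARD('n) * onorm ((*v) A)"
proof -
  have "\<bar>trace A\<bar> \<le> (\<Sum>i\<in>UNIV. \<bar>A $ i $ i\<bar>)" unfolding trace_def by (rule sum_abs)
  also have "\<dots> \<le> (\<Sum>i\<in>(UNIV::'n set). onorm ((*v) A))"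
    by (intro sum_mono matrix_component_le_onorm)
  finally show ?thesis by simp
qed

lemma tendsto_trace:
  fixes F :: "nat \<Rightarrow> real^'n^'n"
  assumes "F \<longlonglongrightarrow> A"
  shows "(\<lambda>k. trace (F k)) \<longlonglongrightarrow> trace A"
  unfolding trace_def by (intro tendsto_sum tendsto_vec_nth assms)

lemma tendsto_matrix_mult:
  fixes F G :: "nat \<Rightarrow> real^'n^'n"
  assumes "F \<longlonglongrightarrow> A" "G \<longlonglongrightarrow> B"
  shows "(\<lambda>k. F k ** G k) \<longlonglongrightarrow> A ** B"
  by (intro vec_tendstoI) (simp add: matrix_mult_nth, intro tendsto_intros assms)

text \<open>Lie--Trotter with the factors \<open>I + S/N\<close> and \<open>I + A/N\<close>, along \<open>N = 2\<^sup>k\<close>.\<close>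
theorem Golden_Thompson:
  fixes S A :: "real^'n^'n"
  assumes S: "transpose S = S" and A: "transpose A = A"
  shows "trace (mexp (S + A)) \<le> trace (mexp S ** mexp A)"
proof -
  define X where "X B N = mat 1 + (1 / real N) *\<^sub>R B" for B :: "real^'n^'n" and N
  define s where "s = onorm ((*v) S)"
  define a where "a = onorm ((*v) A)"
  have nn: "s \<ge> 0" "a \<ge> 0" by (simp_all add: s_def a_def)
  have symX: "transpose (X B N) = X B N" if "transpose B = B" for B N
    using that by (simp add: X_def vec_eq_iff transpose_def mat_def)
  \<comment> \<open>Replacing \<open>I + (S + A)/N\<close> by the product of the two factors costs
    only O(1/N): the factors differ by O(1/N^2), and the \<open>N\<close>-th power magnifies this by
    at most \<open>N * exp (s + a)\<close>.\<close>
  have bound: "trace (mpow (X (S + A) N) N)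
      \<le> trace (mpow (X S N ** X A N) N) + real CARD('n) * (exp (s + a) * s * a) * (1 / real N)"
    if N: "N > 0" for N
  proof -
    let ?U = "X S N ** X A N" and ?V = "X (S + A) N" and ?K = "exp ((s + a) / real N)"
    have oX: "onorm ((*v) (X B N)) \<le> 1 + onorm ((*v) B) / real N" for B
      using onorm_matrix_add_le[of "mat 1" "(1 / real N) *\<^sub>R B"] N
      by (simp add: X_def onorm_mat_1 onorm_matrix_scaleR)
    have "onorm ((*v) ?V) \<le> 1 + onorm ((*v) (S + A)) / real N" by (rule oX)
    also have "\<dots> \<le> 1 + (s + a) / real N"
      using onorm_matrix_add_le[of S A] N by (auto simp: s_def a_def divide_simps)
    also have "\<dots> \<le> ?K" by (rule exp_ge_add_one_self)
    finally have V: "onorm ((*v) ?V) \<le> ?K" .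
    have "onorm ((*v) ?U) \<le> onorm ((*v) (X S N)) * onorm ((*v) (X A N))"
      by (rule onorm_matrix_mult_le)
    also have "\<dots> \<le> (1 + s / real N) * (1 + a / real N)"
      using oX[of S] oX[of A] nn by (intro mult_mono) (auto simp: s_def a_def)
    also have "\<dots> \<le> exp (s / real N) * exp (a / real N)"
      using nn by (intro mult_mono exp_ge_add_one_self) auto
    finally have U: "onorm ((*v) ?U) \<le> ?K" by (simp add: exp_add[symmetric] add_divide_distrib)
    \<comment> \<open>Only the cross term of the product survives.\<close>
    have "?V - ?U = (- 1 / (real N)\<^sup>2) *\<^sub>R (S ** A)"
      by (simp add: X_def matrix_add_ldistrib matrix_add_rdistrib matrix_scalar_ac
          scalar_matrix_assoc[symmetric] power2_eq_square scaleR_add_right)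
    then have "onorm ((*v) (?V - ?U)) = 1 / (real N)\<^sup>2 * onorm ((*v) (S ** A))"
      by (simp only: onorm_matrix_scaleR) simp
    also have "\<dots> \<le> 1 / (real N)\<^sup>2 * (s * a)"
      using onorm_matrix_mult_le[of S A] by (intro mult_left_mono) (auto simp: s_def a_def)
    finally have D: "onorm ((*v) (?V - ?U)) \<le> 1 / (real N)\<^sup>2 * (s * a)" .
    have "onorm ((*v) (mpow ?V N - mpow ?U N)) \<le> real N * ?K ^ N * onorm ((*v) (?V - ?U))"
      using nn by (intro onorm_mpow_diff_le V U) auto
    also have "\<dots> \<le> real N * ?K ^ N * (1 / (real N)\<^sup>2 * (s * a))"
      by (intro mult_left_mono D) auto
    also have "?K ^ N = exp (s + a)" using N by (simp add: exp_of_nat_mult[symmetric])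
    also have "real N * exp (s + a) * (1 / (real N)\<^sup>2 * (s * a)) = exp (s + a) * s * a * (1 / real N)"
      using N by (simp add: power2_eq_square)
    finally have "onorm ((*v) (mpow ?V N - mpow ?U N)) \<le> exp (s + a) * s * a * (1 / real N)" .
    then have "real CARD('n) * onorm ((*v) (mpow ?V N - mpow ?U N))
        \<le> real CARD('n) * (exp (s + a) * s * a * (1 / real N))"
      by (intro mult_left_mono) auto
    then have "\<bar>trace (mpow ?V N - mpow ?U N)\<bar> \<le> real CARD('n) * (exp (s + a) * s * a * (1 / real N))"
      using abs_trace_le_onorm order_trans by blast
    then show ?thesis by (simp add: trace_sub)
  qed
  \<comment> \<open>The product under the power is split by the trace inequality for exponents
    \<open>2 ^ k\<close>; hence the passage to this subsequence.\<close>
  have bound2: "trace (mpow (X (S + A) (2 ^ k)) (2 ^ k))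
      \<le> trace (mpow (X S (2 ^ k)) (2 ^ k) ** mpow (X A (2 ^ k)) (2 ^ k))
        + real CARD('n) * (exp (s + a) * s * a) * (1 / real (2 ^ k))" for k
    using bound[of "2 ^ k"] trace_mpow_power2_le(2)[OF symX[OF S] symX[OF A], of "2 ^ k" "2 ^ k" k]
    by simp
  have sub: "strict_mono (\<lambda>k. 2 ^ k :: nat)" by (auto simp: strict_mono_def)
  have lim: "(\<lambda>k. mpow (X B (2 ^ k)) (2 ^ k)) \<longlonglongrightarrow> mexp B" if "transpose B = B" for B
    using LIMSEQ_subseq_LIMSEQ[OF mexp_LIMSEQ[OF that] sub] by (simp add: X_def o_def)
  have "(\<lambda>k. 1 / real (2 ^ k)) \<longlonglongrightarrow> 0"
    using LIMSEQ_subseq_LIMSEQ[OF lim_1_over_n sub] by (simp add: o_def)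
  then have "(\<lambda>k. trace (mpow (X S (2 ^ k)) (2 ^ k) ** mpow (X A (2 ^ k)) (2 ^ k))
        + real CARD('n) * (exp (s + a) * s * a) * (1 / real (2 ^ k)))
      \<longlonglongrightarrow> trace (mexp S ** mexp A) + real CARD('n) * (exp (s + a) * s * a) * 0"
    by (intro tendsto_add tendsto_trace tendsto_matrix_mult lim S A tendsto_mult tendsto_const)
  moreover have "transpose (S + A) = S + A" using S A by (simp add: vec_eq_iff transpose_def)
  ultimately show ?thesis
    using LIMSEQ_le[OF tendsto_trace[OF lim]] bound2 by fastforce
qed

section \<open>The nuclear norm and the matrices of the triples\<close>

text \<open>The quadratic form is nonnegative at \<open>x - t *\<^sub>R (S *v x)\<close>; its linear
  term in \<open>t\<close> is minus twice the squared norm of \<open>S *v x\<close> and must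
  vanish.\<close>

lemma psd_inner_eq_0_imp:
  assumes "psd S" "x \<bullet> (S *v x) = 0"
  shows "S *v x = 0"
proof -
  have sym: "transpose S = S" and nn: "\<And>y. 0 \<le> y \<bullet> (S *v y)" using assms by (auto simp: psd_def)
  have "2 * t * ((S *v x) \<bullet> (S *v x)) \<le> t\<^sup>2 * ((S *v x) \<bullet> (S *v (S *v x)))" for t
  proof -
    let ?y = "S *v x"
    have "0 \<le> (x + (- t) *\<^sub>R ?y) \<bullet> (S *v (x + (- t) *\<^sub>R ?y))" by (rule nn)
    moreover have "x \<bullet> (S *v ?y) = ?y \<bullet> ?y" using symmetric_inner_swap[OF sym, of x ?y] by simp
    ultimately show ?thesis using assms(2)
      by (simp add: inner_add_left inner_add_right inner_diff_left inner_diff_right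
          matrix_vector_right_distrib matrix_vector_mult_diff_distrib
          matrix_vector_mult_scaleR power2_eq_square algebra_simps)
  qed
  then show ?thesis using linear_le_quadratic_imp_zero by fastforce
qed

lemma matrix_diff_ldistrib: "A ** (B - C) = A ** B - A ** (C :: real^'n^'n)"
  by (simp add: vec_eq_iff matrix_mult_nth algebra_simps sum_subtractf)

lemma matrix_diff_rdistrib: "(A - B) ** C = A ** C - B ** (C :: real^'n^'n)"
  by (simp add: vec_eq_iff matrix_mult_nth algebra_simps sum_subtractf)

text \<open>Exhibits the trace as a sum of quadratic forms, each nonnegative when \<open>S\<close>
  is positive semidefinite, so that a vanishing total makes every term vanish.\<close>

lemma trace_sandwich:
  fixes D S :: "real^'n^'n"
  assumes "transpose D = D"
  shows "trace (D ** S ** D) = (\<Sum>k\<in>UNIV. column k D \<bullet> (S *v column k D))"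
proof -
  have "D $ i $ j = D $ j $ i" for i j
    using arg_cong[OF assms, of "\<lambda>M. M $ j $ i"] by (simp add: transpose_def)
  then have "column k D = D $ k" for k by (simp add: column_def vec_eq_iff)
  moreover have "trace (D ** S ** D) = (\<Sum>k\<in>UNIV. D $ k \<bullet> (S *v column k D))"
    by (simp add: matrix_mul_assoc[symmetric] trace_def matrix_mult_nth inner_matrix_vector
        sum_distrib_left mult.assoc column_def)
  ultimately show ?thesis by simp
qed

text \<open>With \<open>D = S - G\<close> and \<open>S\<^sup>2 = G\<^sup>2\<close>, the matrix \<open>S + G\<close> anticommutes with \<open>D\<close>, so
  \<open>tr (D(S + G)D) = 0\<close>; hence both \<open>S\<close> and \<open>G\<close> annihilate the columns of \<open>D\<close>, and \<open>D\<^sup>2 = 0\<close>.\<close>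
lemma psd_sqrt_unique:
  fixes S G :: "real^'n^'n"
  assumes S: "psd S" and G: "psd G" and eq: "S ** S = G ** G"
  shows "S = G"
proof -
  define D where "D = S - G"
  have symD: "transpose D = D" using S G by (auto simp: D_def psd_def transpose_def vec_eq_iff)
  have anti: "D ** (S + G) = - ((S + G) ** D)"
    by (simp add: D_def matrix_diff_ldistrib matrix_diff_rdistrib matrix_add_ldistrib
        matrix_add_rdistrib eq)
  have "trace (D ** (S + G) ** D) = trace (D ** ((S + G) ** D))" by (simp add: matrix_mul_assoc)
  also have "\<dots> = trace ((S + G) ** D ** D)" by (rule trace_mul_sym)
  also have "(S + G) ** D = - (D ** (S + G))" using anti by simp
  also have "trace (- (D ** (S + G)) ** D) = - trace (D ** (S + G) ** D)"
    by (simp add: trace_def matrix_mult_nth sum_negf)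
  finally have "trace (D ** (S + G) ** D) = 0" by simp
  then have "trace (D ** S ** D) + trace (D ** G ** D) = 0"
    by (simp add: matrix_add_ldistrib matrix_add_rdistrib trace_add)
  then have sum0: "(\<Sum>k\<in>UNIV. column k D \<bullet> (S *v column k D) + column k D \<bullet> (G *v column k D)) = 0"
    by (simp add: trace_sandwich[OF symD] sum.distrib)
  have nn: "0 \<le> x \<bullet> (S *v x)" "0 \<le> x \<bullet> (G *v x)" for x using S G by (auto simp: psd_def)
  have "column k D \<bullet> (S *v column k D) + column k D \<bullet> (G *v column k D) = 0" for k
    using sum0 by (subst (asm) sum_nonneg_eq_0_iff) (auto intro: add_nonneg_nonneg nn)
  then have "S *v column k D = 0" "G *v column k D = 0" for k
    using nn[of "column k D"] psd_inner_eq_0_imp[OF S] psd_inner_eq_0_imp[OF G]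
    by (metis add_nonneg_eq_0_iff)+
  then have "D *v column k D = 0" for k by (simp add: D_def matrix_vector_mult_diff_rdistrib)
  then have "column k D \<bullet> column k D = 0" for k
  proof -
    have "column k D = D *v axis k 1" by (simp add: matrix_vector_mult_basis)
    then have "column k D \<bullet> column k D = axis k 1 \<bullet> (D *v column k D)"
      using symmetric_inner_swap[OF symD, of "axis k 1" "column k D"] by simp
    then show ?thesis using \<open>D *v column k D = 0\<close> by simp
  qed
  then have "D = 0" by (auto simp: vec_eq_iff column_def)
  then show ?thesis by (simp add: D_def)
qed

text \<open>By symmetry \<open>transpose G ** G\<close> is the square of \<open>G\<close>, whose
  unique positive semidefinite root is \<open>G\<close>.\<close>

lemma nuclear_norm_psd:
  fixes G :: "real^'n^'n"
  assumes "psd G"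
  shows "nuclear_norm G = trace G"
proof -
  have "(THE S. psd S \<and> S ** S = transpose G ** G) = G"
    using assms psd_sqrt_unique by (intro the_equality) (auto simp: psd_def)
  then show ?thesis by (simp add: nuclear_norm_def)
qed

section \<open>The log-trace potential\<close>

text \<open>The inner product is an average of eigenvalues of \<open>A\<close> with nonnegative
  weights of total \<open>trace G\<close>, and each eigenvalue is at most the potential divided by
  \<theta>.\<close>

lemma frob_inner_le_log_trace_mexp:
  fixes A G :: "real^'n^'n"
  assumes A: "transpose A = A" "trace A = 0" and G: "psd G" "trace G \<le> lam" and \<theta>: "\<theta> > 0"
  shows "frob_inner A G \<le> lam * (ln (trace (mexp (\<theta> *\<^sub>R A))) / \<theta>)"
proof -
  obtain P d where sp: "spectral P d A" by (rule symmetric_spectral_decomposition[OF A(1)])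
  have "spectral P (\<lambda>k. \<theta> * d k) (\<theta> *\<^sub>R A)" using spectral_affine[OF sp, of 0 \<theta>] by simp
  then have Z: "trace (mexp (\<theta> *\<^sub>R A)) = (\<Sum>k\<in>UNIV. exp (\<theta> * d k))"
    by (intro trace_spectral[OF spectral_mexp])
  let ?Z = "trace (mexp (\<theta> *\<^sub>R A))"
  let ?q = "\<lambda>k. column k P \<bullet> (G *v column k P)"
  have q: "0 \<le> ?q k" for k using G by (simp add: psd_def)
  have sd: "(\<Sum>k\<in>UNIV. d k) = 0" using trace_spectral[OF sp] A by simp
  \<comment> \<open>Since \<open>trace A = 0\<close>, the bound \<open>1 + x \<le> exp x\<close>
    gives \<open>?Z \<ge> 1\<close>. The logarithm is then nonnegative, which allows
    \<open>trace G\<close> to be enlarged to \<open>lam\<close> at the end.\<close>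
  have "1 \<le> real CARD('n)" by (simp add: Suc_leI)
  also have "real CARD('n) = (\<Sum>k\<in>(UNIV::'n set). 1 + \<theta> * d k)"
    by (simp add: sum.distrib sum_distrib_left[symmetric] sd)
  also have "\<dots> \<le> ?Z" unfolding Z by (intro sum_mono) simp
  finally have Z1: "?Z \<ge> 1" .
  have dk: "d k \<le> ln ?Z / \<theta>" for k
  proof -
    have "exp (\<theta> * d k) \<le> ?Z" unfolding Z by (rule member_le_sum) auto
    then have "\<theta> * d k \<le> ln ?Z" using Z1 by (simp add: ln_ge_iff)
    then show ?thesis using \<theta> by (simp add: field_simps)
  qed
  have "frob_inner A G = trace (G ** A)" unfolding frob_inner_def by (rule trace_mul_sym)
  also have "\<dots> = (\<Sum>k\<in>UNIV. d k * ?q k)" by (rule trace_spectral_mult[OF sp])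
  also have "\<dots> \<le> (\<Sum>k\<in>UNIV. ln ?Z / \<theta> * ?q k)" by (intro sum_mono mult_right_mono dk q)
  also have "\<dots> = ln ?Z / \<theta> * trace G"
    using trace_spectral_mult[OF spectral_one[OF sp], of G] by (simp add: sum_distrib_left)
  also have "\<dots> \<le> ln ?Z / \<theta> * lam" using G Z1 \<theta> by (intro mult_left_mono) auto
  finally show ?thesis by (simp add: mult.commute)
qed

text \<open>The range fits the application \<open>x = \<theta> * d\<close> with
  \<open>\<theta>\<^sup>2 \<le> 3 / 4\<close> and \<open>d\<^sup>2 \<le> 3\<close>.\<close>

lemma exp_plus_exp_minus_le:
  fixes x :: real
  assumes "x\<^sup>2 \<le> 9 / 4"
  shows "exp x + exp (- x) \<le> 2 + 2 * x\<^sup>2"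
proof -
  have main: "exp x + exp (- x) \<le> 2 + 2 * x\<^sup>2" if "0 \<le> x" "x \<le> 3 / 2" for x :: real
  proof -
    \<comment> \<open>In terms of the half angle the left side minus 2 is the square of
      \<open>exp y - exp (- y)\<close>. The slope 11/4 is 2 + 3/4, and (11/8)^2 = 121/64 is below
      2.\<close>
    define y where "y = x / 2"
    have y: "0 \<le> y" "y \<le> 3 / 4" using that by (auto simp: y_def)
    have "exp y \<le> 1 + y + y\<^sup>2" using y by (intro exp_bound) auto
    moreover have "1 - y \<le> exp (- y)" using exp_ge_add_one_self[of "- y"] by simp
    ultimately have "exp y - exp (- y) \<le> 2 * y + y * y" by (simp add: power2_eq_square)
    also have "y * y \<le> y * (3 / 4)" using y by (intro mult_left_mono) auto
    finally have le: "exp y - exp (- y) \<le> (11 / 4) * y" by simp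
    have "exp x + exp (- x) - 2 = (exp y - exp (- y))\<^sup>2"
      by (simp add: y_def power2_eq_square algebra_simps flip: exp_add)
    also have "\<dots> \<le> ((11 / 4) * y)\<^sup>2" using le y by (intro power_mono) auto
    also have "\<dots> \<le> 2 * x\<^sup>2" by (simp add: y_def power2_eq_square)
    finally show ?thesis by simp
  qed
  have "\<bar>x\<bar> \<le> 3 / 2"
    using assms by (intro power2_le_imp_le[of "\<bar>x\<bar>"]) (auto simp: power2_eq_square)
  then show ?thesis using main[of x] main[of "- x"] by (cases "x \<ge> 0") auto
qed

section \<open>The matrices of the triples\<close>

lemma Lmat_mult_vec:
  fixes i j k :: "'n::finite"
  assumes "i \<noteq> j" "i \<noteq> k" "j \<noteq> k"
  shows "Lmat (i, j, k) *v x = (\<chi> a. if a = i then x $ k - x $ j else if a = j then x $ j - x $ i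
           else if a = k then x $ i - x $ k else 0)"
proof -
  have [simp]: "j \<noteq> i" "k \<noteq> i" "k \<noteq> j" using assms by auto
  have "(Lmat (i, j, k) *v x) $ a = (if a = i then x $ k - x $ j else if a = j then x $ j - x $ i
           else if a = k then x $ i - x $ k else 0)" for a
  proof -
    have "(Lmat (i, j, k) *v x) $ a =
      (\<Sum>b\<in>UNIV. (if b = j then if a = j then x $ b else 0 else 0) - (if b = k then if a = k then x $ b else 0 else 0)
         - (if b = j then if a = i then x $ b else 0 else 0) - (if b = i then if a = j then x $ b else 0 else 0)
         + (if b = k then if a = i then x $ b else 0 else 0) + (if b = i then if a = k then x $ b else 0 else 0))"
      unfolding Lmat_def matrix_vector_mult_def by (simp, intro sum.cong refl) (use assms in auto)
    also have "\<dots> = (if a = i then x $ k - x $ j else if a = j then x $ j - x $ i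
           else if a = k then x $ i - x $ k else 0)"
      using assms by (simp add: sum.distrib sum_subtractf)
    finally show ?thesis .
  qed
  then show ?thesis by (simp add: vec_eq_iff)
qed

lemma trace_mult_columns: "trace (A ** B) = (\<Sum>a\<in>UNIV. (A *v column a B) $ a)"
  by (simp add: trace_mult_nth matrix_vector_mult_def column_def)

lemma sum_three_cases:
  fixes i j k :: "'n::finite" and f g h :: "'n \<Rightarrow> real"
  assumes "i \<noteq> j" "i \<noteq> k" "j \<noteq> k"
  shows "(\<Sum>a\<in>UNIV. if a = i then f a else if a = j then g a else if a = k then h a else 0) = f i + g j + h k"
proof -
  have "(\<Sum>a\<in>UNIV. if a = i then f a else if a = j then g a else if a = k then h a else 0)
     = (\<Sum>a\<in>UNIV. (if a = i then f a else 0) + (if a = j then g a else 0) + (if a = k then h a else 0))"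
    by (intro sum.cong refl) (use assms in auto)
  then show ?thesis by (simp add: sum.distrib)
qed

lemma trace_Lmat_mult:
  assumes "i \<noteq> j" "i \<noteq> k" "j \<noteq> k"
  shows "trace (Lmat (i, j, k) ** G) = G $ k $ i - G $ j $ i + (G $ j $ j - G $ i $ j) + (G $ i $ k - G $ k $ k)"
  unfolding trace_mult_columns Lmat_mult_vec[OF assms]
  using assms by (simp add: sum_three_cases column_def)

text \<open>On the block of coordinates \<open>i\<close>, \<open>j\<close>, \<open>k\<close> the
  square of the matrix has diagonal entries 2 and off-diagonal entries -1.\<close>

lemma trace_Lmat_square_mult:
  assumes "i \<noteq> j" "i \<noteq> k" "j \<noteq> k"
  shows "trace (Lmat (i, j, k) ** (Lmat (i, j, k) ** M))
     = 2 * (M $ i $ i + M $ j $ j + M $ k $ k)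
       - (M $ i $ j + M $ j $ i + M $ i $ k + M $ k $ i + M $ j $ k + M $ k $ j)"
proof -
  have "trace (Lmat (i, j, k) ** (Lmat (i, j, k) ** M))
     = (\<Sum>a\<in>UNIV. (Lmat (i, j, k) *v (Lmat (i, j, k) *v column a M)) $ a)"
    by (simp add: matrix_mul_assoc trace_mult_columns matrix_vector_mul_assoc)
  then show ?thesis unfolding Lmat_mult_vec[OF assms]
    using assms by (simp add: sum_three_cases column_def)
qed

lemma transpose_Lmat: "transpose (Lmat t) = Lmat t"
  by (cases t) (simp add: Lmat_def transpose_def vec_eq_iff conj_commute disj_commute)

lemma trace_Lmat:
  assumes "i \<noteq> j" "i \<noteq> k" "j \<noteq> k"
  shows "trace (Lmat (i, j, k)) = 0"
  using trace_Lmat_mult[OF assms, of "mat 1"] assms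
  by (simp only: matrix_mul_rid) (simp add: mat_def)

text \<open>On the coordinates \<open>i, j, k\<close> an eigenvector with \<open>d \<noteq> 0\<close> has coordinate sum zero, and there
  \<open>L\<^sup>2 = 3 I - J\<close>; hence \<open>d\<^sup>2 = 3\<close>.\<close>
lemma Lmat_eigenvalue_le:
  assumes dist: "i \<noteq> j" "i \<noteq> k" "j \<noteq> k" and ev: "Lmat (i, j, k) *v x = d *\<^sub>R x" and "x \<noteq> 0"
  shows "d\<^sup>2 \<le> 3"
proof (cases "d = 0")
  case False
  have e: "d * x $ a = (if a = i then x $ k - x $ j else if a = j then x $ j - x $ i
           else if a = k then x $ i - x $ k else 0)" for a
    using arg_cong[OF ev, of "\<lambda>v. v $ a"] unfolding Lmat_mult_vec[OF dist] by simp
  have ei: "d * x $ i = x $ k - x $ j" and ej: "d * x $ j = x $ j - x $ i" and ek: "d * x $ k = x $ i - x $ k"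
    using e[of i] e[of j] e[of k] dist by auto
  have z: "x $ a = 0" if "a \<noteq> i" "a \<noteq> j" "a \<noteq> k" for a using e[of a] that False by simp
  have "d * (x $ i + x $ j + x $ k) = 0" using ei ej ek by (simp add: algebra_simps)
  then have s: "x $ i + x $ j + x $ k = 0" using False by simp
  have "d * (d * x $ i) = 3 * x $ i" "d * (d * x $ j) = 3 * x $ j" "d * (d * x $ k) = 3 * x $ k"
    unfolding ei ej ek right_diff_distrib using ei ej ek s by auto
  then have "(d\<^sup>2 - 3) * x $ a = 0" for a
    using z[of a] by (cases "a = i"; cases "a = j"; cases "a = k") (auto simp: power2_eq_square algebra_simps)
  moreover obtain a where "x $ a \<noteq> 0" using \<open>x \<noteq> 0\<close> by (auto simp: vec_eq_iff)
  ultimately show ?thesis by (metis eq_iff_diff_eq_0 mult_eq_0_iff order_refl)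
qed simp

text \<open>In an eigenbasis the two exponentials add up to \<open>2 cosh (\<theta> d)\<close>, at
  most \<open>2 + 2 \<theta>\<^sup>2 d\<^sup>2\<close>. The quadratic part is the trace of
  \<open>M\<close> times the squared matrix, which only involves the block of \<open>i\<close>,
  \<open>j\<close>, \<open>k\<close>.\<close>

lemma trace_mexp_Lmat_le:
  assumes dist: "i \<noteq> j" "i \<noteq> k" "j \<noteq> k" and M: "psd M" and \<theta>: "\<theta>\<^sup>2 \<le> 3 / 4"
  shows "trace (M ** mexp (\<theta> *\<^sub>R Lmat (i, j, k))) + trace (M ** mexp (\<theta> *\<^sub>R (- Lmat (i, j, k))))
    \<le> 2 * trace M + 6 * \<theta>\<^sup>2 * (M $ i $ i + M $ j $ j + M $ k $ k)"
proof -
  let ?L = "Lmat (i, j, k)"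
  obtain P d where sp: "spectral P d ?L" by (rule symmetric_spectral_decomposition[OF transpose_Lmat])
  let ?q = "\<lambda>r. column r P \<bullet> (M *v column r P)"
  have q: "0 \<le> ?q r" for r using M by (simp add: psd_def)
  have sp1: "spectral P (\<lambda>r. c * d r) (c *\<^sub>R ?L)" for c using spectral_affine[OF sp, of 0 c] by simp
  have T: "trace (M ** mexp (c *\<^sub>R ?L)) = (\<Sum>r\<in>UNIV. exp (c * d r) * ?q r)" for c
    by (rule trace_spectral_mult[OF spectral_mexp[OF sp1]])
  have d3: "(d r)\<^sup>2 \<le> 3" for r
    using column_orthonormal[OF sp, of r] by (intro Lmat_eigenvalue_le[OF dist spectral_eigenvector[OF sp, of r]]) auto
  have cosh: "exp (\<theta> * d r) + exp (- \<theta> * d r) \<le> 2 + 2 * \<theta>\<^sup>2 * (d r)\<^sup>2" for r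
  proof -
    have "(\<theta> * d r)\<^sup>2 \<le> 3 / 4 * 3" unfolding power_mult_distrib using \<theta> d3[of r] by (intro mult_mono) auto
    then show ?thesis using exp_plus_exp_minus_le[of "\<theta> * d r"] by (simp add: power_mult_distrib)
  qed
  have "trace (M ** mexp (\<theta> *\<^sub>R ?L)) + trace (M ** mexp (\<theta> *\<^sub>R (- ?L)))
     = (\<Sum>r\<in>UNIV. (exp (\<theta> * d r) + exp (- \<theta> * d r)) * ?q r)"
    using T[of \<theta>] T[of "- \<theta>"] by (simp add: sum.distrib distrib_right)
  also have "\<dots> \<le> (\<Sum>r\<in>UNIV. (2 + 2 * \<theta>\<^sup>2 * (d r)\<^sup>2) * ?q r)"
    by (intro sum_mono mult_right_mono cosh q)
  also have "\<dots> = 2 * (\<Sum>r\<in>UNIV. 1 * ?q r) + 2 * \<theta>\<^sup>2 * (\<Sum>r\<in>UNIV. d r * d r * ?q r)"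
    by (simp add: sum.distrib distrib_right sum_distrib_left power2_eq_square mult.assoc)
  also have "(\<Sum>r\<in>UNIV. 1 * ?q r) = trace M"
    using trace_spectral_mult[OF spectral_one[OF sp], of M] by simp
  also have "(\<Sum>r\<in>UNIV. d r * d r * ?q r) = trace (M ** (?L ** ?L))"
    using trace_spectral_mult[OF spectral_mult[OF sp sp], of M] by simp
  also have "\<dots> = trace (?L ** (?L ** M))"
    using trace_mul_sym[of M "?L ** ?L"] by (simp add: matrix_mul_assoc)
  also have "2 * trace M + 2 * \<theta>\<^sup>2 * trace (?L ** (?L ** M))
      \<le> 2 * trace M + 2 * \<theta>\<^sup>2 * (3 * (M $ i $ i + M $ j $ j + M $ k $ k))"
  proof (intro add_left_mono mult_left_mono)
    \<comment> \<open>The gap between the two sides is exactly the quadratic form of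
      \<open>M\<close> at this vector.\<close>
    let ?x = "axis i 1 + axis j 1 + axis k 1 :: real^'a"
    have "0 \<le> ?x \<bullet> (M *v ?x)" using M by (simp add: psd_def)
    then show "trace (?L ** (?L ** M)) \<le> 3 * (M $ i $ i + M $ j $ j + M $ k $ k)"
      unfolding trace_Lmat_square_mult[OF dist]
      by (simp add: inner_add_left inner_add_right matrix_vector_right_distrib
          matrix_vector_mult_basis inner_axis' column_def)
  qed simp
  finally show ?thesis by (simp add: algebra_simps)
qed

section \<open>Averaging over the triples\<close>

lemma finite_triples [simp]: "finite (triples :: ('n::{finite,linorder}) triple set)"
  by (rule finite_subset[OF subset_UNIV]) simp

lemma triplesD:
  assumes "(i, j, k) \<in> triples"
  shows "i \<noteq> j" "i \<noteq> k" "j \<noteq> k"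
  using assms by (auto simp: triples_def)

lemma triples_nonempty:
  assumes "CARD('n::{finite,linorder}) \<ge> 3"
  shows "(triples :: 'n triple set) \<noteq> {}"
proof -
  obtain B :: "'n set" where "card B = 3" using obtain_subset_with_card_n[OF assms] by blast
  then obtain i j k :: 'n where "i \<noteq> j" "i \<noteq> k" "j \<noteq> k" unfolding card_3_iff by blast
  then have "(i, j, k) \<in> triples \<or> (i, k, j) \<in> triples" by (auto simp: triples_def)
  then show ?thesis by blast
qed

text \<open>By symmetry every index lies in equally many triples, so three entries picked by a
  random triple average to 3/n of the total. This is the source of the factor 1/n in the growth of
  the potential.\<close>

lemma sum_over_triples:
  fixes f :: "'n::{finite,linorder} \<Rightarrow> real"
  shows "real CARD('n) * (\<Sum>(i,j,k)\<in>triples. f i + f j + f k) = 3 * real (card (triples :: 'n triple set)) * sum f UNIV"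
proof -
  \<comment> \<open>\<open>D\<close> drops the order constraint, which makes the three positions
    interchangeable and doubles the number of triples; \<open>c\<close> counts the completions of a
    given first index.\<close>
  define D :: "'n triple set" where "D = (SIGMA i:UNIV. SIGMA j:-{i}. -{i,j})"
  define c where "c = (CARD('n) - 1) * (CARD('n) - 2)"
  have D: "(i, j, k) \<in> D \<longleftrightarrow> i \<noteq> j \<and> i \<noteq> k \<and> j \<noteq> k" for i j k by (auto simp: D_def)
  define s where "s = (\<lambda>(i::'n, j::'n, k::'n). (i, k, j))"
  have Ds: "D = triples \<union> s ` triples"
  proof -
    have "(i, j, k) \<in> D \<longleftrightarrow> (i, j, k) \<in> triples \<union> s ` triples" for i j k
    proof -
      have "(i, j, k) \<in> s ` triples \<longleftrightarrow> (i, k, j) \<in> triples" by (force simp: s_def image_iff)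
      then show ?thesis by (auto simp: D triples_def)
    qed
    then show ?thesis by auto
  qed
  have disj: "triples \<inter> s ` triples = {}" by (auto simp: s_def triples_def)
  have inj: "inj_on s triples" by (auto simp: s_def inj_on_def)
  have half: "sum g D = 2 * sum g triples" if "\<And>t. g (s t) = g t" for g :: "'n triple \<Rightarrow> real"
    unfolding Ds by (subst sum.union_disjoint) (use disj inj that in \<open>simp_all add: sum.reindex\<close>)
  have cD: "card (SIGMA j:-{i}. -{i,j}) = c" for i :: 'n
  proof -
    have "card (- {i, j}) = CARD('n) - 2" if "j \<in> - {i}" for j
      using that by (simp add: Compl_eq_Diff_UNIV card_Diff_subset)
    then have "card (SIGMA j:-{i}. -{i,j}) = (\<Sum>j\<in>-{i}. CARD('n) - 2)"
      by (subst card_SigmaI) auto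
    then show ?thesis by (simp add: c_def Compl_eq_Diff_UNIV)
  qed
  have first: "(\<Sum>(i,j,k)\<in>D. f i) = real c * sum f UNIV"
  proof -
    have "(\<Sum>(i,j,k)\<in>D. f i) = (\<Sum>i\<in>UNIV. \<Sum>jk\<in>(SIGMA j:-{i}. -{i,j}). f i)"
      unfolding D_def by (subst sum.Sigma) (auto intro!: sum.cong)
    then show ?thesis by (simp add: cD sum_distrib_left)
  qed
  have second: "(\<Sum>(i,j,k)\<in>D. f j) = (\<Sum>(i,j,k)\<in>D. f i)"
    by (rule sum.reindex_bij_witness[of _ "\<lambda>(i,j,k). (j,i,k)" "\<lambda>(i,j,k). (j,i,k)"]) (auto simp: D)
  have third: "(\<Sum>(i,j,k)\<in>D. f k) = (\<Sum>(i,j,k)\<in>D. f i)"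
    by (rule sum.reindex_bij_witness[of _ "\<lambda>(i,j,k). (k,j,i)" "\<lambda>(i,j,k). (k,j,i)"]) (auto simp: D)
  have a: "(\<Sum>(i,j,k)\<in>D. f i + f j + f k) = 3 * (real c * sum f UNIV)"
    using first second third by (simp add: case_prod_unfold sum.distrib)
  have b: "(\<Sum>(i,j,k)\<in>D. f i + f j + f k) = 2 * (\<Sum>(i,j,k)\<in>triples. f i + f j + f k)"
    by (rule half) (auto simp: s_def)
  have "real (card D) = 2 * real (card (triples :: 'n triple set))"
    using half[of "\<lambda>_. 1"] by simp
  moreover have "card D = CARD('n) * c" unfolding D_def by (subst card_SigmaI) (auto simp: cD)
  ultimately have d: "real CARD('n) * real c = 2 * real (card (triples :: 'n triple set))" by simp
  have "2 * (real CARD('n) * (\<Sum>(i,j,k)\<in>triples. f i + f j + f k))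
      = real CARD('n) * (\<Sum>(i,j,k)\<in>D. f i + f j + f k)" using b by simp
  also have "\<dots> = 3 * (real CARD('n) * real c) * sum f UNIV" unfolding a by (simp only: mult_ac)
  also have "\<dots> = 2 * (3 * real (card (triples :: 'n triple set)) * sum f UNIV)"
    unfolding d by (simp only: mult_ac)
  finally show ?thesis by simp
qed

section \<open>Growth of the potential in one step\<close>

lemma trace_mexp_pos:
  assumes "transpose A = A"
  shows "0 < trace (mexp A)"
proof -
  obtain P d where "spectral P d A" by (rule symmetric_spectral_decomposition[OF assms])
  then show ?thesis by (subst trace_spectral[OF spectral_mexp]) (auto intro: sum_pos)
qed

lemma psd_mexp:
  assumes "transpose A = A"
  shows "psd (mexp A)"
proof -
  obtain P d where "spectral P d A" by (rule symmetric_spectral_decomposition[OF assms])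
  then show ?thesis by (rule spectral_psd[OF spectral_mexp]) simp
qed

lemma transpose_add: "transpose (A + B) = transpose A + transpose (B :: real^'n^'m)"
  by (simp add: vec_eq_iff transpose_def)

lemma transpose_minus: "transpose (- A) = - transpose (A :: real^'n^'m)"
  by (simp add: vec_eq_iff transpose_def)

text \<open>Golden--Thompson decouples the new summand from \<open>A\<close>, and the tangent of the logarithm at
  \<open>tr (exp (\<theta>A))\<close> replaces Jensen's inequality.\<close>
lemma sum_log_trace_mexp_step:
  fixes A :: "real^('n::{finite,linorder})^('n::{finite,linorder})"
  assumes A: "transpose A = A" and \<theta>: "\<theta>\<^sup>2 \<le> 3 / 4"
  shows "(\<Sum>t\<in>triples. ln (trace (mexp (\<theta> *\<^sub>R (A + Lmat t)))) + ln (trace (mexp (\<theta> *\<^sub>R (A - Lmat t)))))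
     \<le> 2 * real (card (triples :: 'n triple set)) * (ln (trace (mexp (\<theta> *\<^sub>R A))) + 9 * \<theta>\<^sup>2 / real CARD('n))"
proof -
  define M where "M = mexp (\<theta> *\<^sub>R A)"
  define c where "c = trace M"
  define N where "N = real (card (triples :: 'n triple set))"
  have sA: "transpose (\<theta> *\<^sub>R A) = \<theta> *\<^sub>R A" using A by (simp add: transpose_scalar)
  have M: "psd M" and c: "c > 0" unfolding c_def M_def by (rule psd_mexp[OF sA], rule trace_mexp_pos[OF sA])
  have tangent: "ln x \<le> ln c + x / c - 1" if "x > 0" for x
    using ln_le_minus_one[of "x / c"] that c by (simp add: ln_div)
  have le: "ln (trace (mexp (\<theta> *\<^sub>R (A + B)))) \<le> ln c - 1 + trace (M ** mexp (\<theta> *\<^sub>R B)) / c"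
    if B: "transpose B = B" for B
  proof -
    have sB: "transpose (\<theta> *\<^sub>R B) = \<theta> *\<^sub>R B" using B by (simp add: transpose_scalar)
    have "trace (mexp (\<theta> *\<^sub>R (A + B))) \<le> trace (M ** mexp (\<theta> *\<^sub>R B))"
      using Golden_Thompson[OF sA sB] by (simp add: M_def scaleR_add_right)
    moreover have "0 < trace (mexp (\<theta> *\<^sub>R (A + B)))"
      using A B by (intro trace_mexp_pos) (simp add: transpose_scalar transpose_add)
    ultimately show ?thesis using tangent[of "trace (mexp (\<theta> *\<^sub>R (A + B)))"] c
      by (smt (verit) divide_right_mono)
  qed
  have step: "ln (trace (mexp (\<theta> *\<^sub>R (A + Lmat (i,j,k))))) + ln (trace (mexp (\<theta> *\<^sub>R (A - Lmat (i,j,k)))))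
      \<le> 2 * ln c + 6 * \<theta>\<^sup>2 / c * (M $ i $ i + M $ j $ j + M $ k $ k)"
    if "(i, j, k) \<in> triples" for i j k
  proof -
    let ?L = "Lmat (i, j, k)"
    have "ln (trace (mexp (\<theta> *\<^sub>R (A + ?L)))) + ln (trace (mexp (\<theta> *\<^sub>R (A - ?L))))
      \<le> 2 * ln c - 2 + (trace (M ** mexp (\<theta> *\<^sub>R ?L)) + trace (M ** mexp (\<theta> *\<^sub>R (- ?L)))) / c"
      using le[OF transpose_Lmat, of "(i,j,k)"] le[of "- ?L"]
      by (simp add: transpose_minus transpose_Lmat add_divide_distrib)
    also have "\<dots> \<le> 2 * ln c - 2 + (2 * c + 6 * \<theta>\<^sup>2 * (M $ i $ i + M $ j $ j + M $ k $ k)) / c"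
      using trace_mexp_Lmat_le[OF triplesD[OF that] M \<theta>] c
      by (intro add_left_mono divide_right_mono) (auto simp: c_def)
    also have "\<dots> = 2 * ln c + 6 * \<theta>\<^sup>2 / c * (M $ i $ i + M $ j $ j + M $ k $ k)"
      using c by (simp add: field_simps)
    finally show ?thesis .
  qed
  have "(\<Sum>t\<in>triples. ln (trace (mexp (\<theta> *\<^sub>R (A + Lmat t)))) + ln (trace (mexp (\<theta> *\<^sub>R (A - Lmat t)))))
     \<le> (\<Sum>(i,j,k)\<in>triples. 2 * ln c + 6 * \<theta>\<^sup>2 / c * (M $ i $ i + M $ j $ j + M $ k $ k))"
    using step by (intro sum_mono) auto
  also have "\<dots> = 2 * N * ln c + 6 * \<theta>\<^sup>2 / c * (\<Sum>(i,j,k)\<in>triples. M $ i $ i + M $ j $ j + M $ k $ k)"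
    unfolding sum_distrib_left by (simp add: case_prod_unfold sum.distrib N_def)
  \<comment> \<open>The factor \<open>c\<close> cancels against the division by \<open>c\<close>
    from the tangent, so the increment does not depend on \<open>A\<close>.\<close>
  also have "(\<Sum>(i,j,k)\<in>triples. M $ i $ i + M $ j $ j + M $ k $ k) = 3 * N * c / real CARD('n)"
    using sum_over_triples[of "\<lambda>i. M $ i $ i"] by (simp add: c_def trace_def N_def field_simps)
  also have "2 * N * ln c + 6 * \<theta>\<^sup>2 / c * (3 * N * c / real CARD('n)) = 2 * N * (ln c + 9 * \<theta>\<^sup>2 / real CARD('n))"
    using c by (simp add: field_simps)
  finally show ?thesis by (simp add: N_def c_def M_def)
qed

section \<open>McDiarmid's inequality\<close>

lemma expectation_pmf_mono:
  fixes f g :: "'a \<Rightarrow> real"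
  assumes "finite (set_pmf q)" "\<And>x. x \<in> set_pmf q \<Longrightarrow> f x \<le> g x"
  shows "measure_pmf.expectation q f \<le> measure_pmf.expectation q g"
  using assms by (intro integral_mono_AE integrable_measure_pmf_finite) (auto simp: AE_measure_pmf_iff)

lemma expectation_pmf_add:
  fixes f g :: "'a \<Rightarrow> real"
  assumes "finite (set_pmf q)"
  shows "measure_pmf.expectation q (\<lambda>x. f x + g x) = measure_pmf.expectation q f + measure_pmf.expectation q g"
  using assms by (intro Bochner_Integration.integral_add integrable_measure_pmf_finite)

lemma expectation_bind_pmf_finite:
  fixes h :: "'b \<Rightarrow> real"
  assumes "finite (set_pmf q)" "\<And>x. x \<in> set_pmf q \<Longrightarrow> finite (set_pmf (f x))"
  shows "measure_pmf.expectation (q \<bind> f) h = measure_pmf.expectation q (\<lambda>x. measure_pmf.expectation (f x) h)"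
  using assms by (subst pmf_expectation_bind[of "set_pmf q"]) (auto simp: integral_measure_pmf[of "set_pmf q"])

lemma finite_set_replicate_pmf: "finite (set_pmf q) \<Longrightarrow> finite (set_pmf (replicate_pmf m q))"
  using finite_lists_length_eq[of "set_pmf q" m]
  by (simp add: set_replicate_pmf lists_eq_set conj_commute)

lemma expectation_replicate_pmf_Suc:
  fixes h :: "'a list \<Rightarrow> real"
  assumes "finite (set_pmf q)"
  shows "measure_pmf.expectation (replicate_pmf (Suc m) q) h
     = measure_pmf.expectation q (\<lambda>x. measure_pmf.expectation (replicate_pmf m q) (\<lambda>xs. h (x # xs)))"
  using assms finite_set_replicate_pmf[OF assms]
  by (simp add: expectation_bind_pmf_finite)

text \<open>With the first point integrated innermost, it can be symmetrized while the other points
  are held fixed.\<close>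

lemma expectation_replicate_pmf_Suc':
  fixes h :: "'a list \<Rightarrow> real"
  assumes "finite (set_pmf q)"
  shows "measure_pmf.expectation (replicate_pmf (Suc m) q) h
     = measure_pmf.expectation (replicate_pmf m q) (\<lambda>xs. measure_pmf.expectation q (\<lambda>x. h (x # xs)))"
  unfolding replicate_pmf.simps bind_commute_pmf[of q]
  using assms finite_set_replicate_pmf[OF assms]
  by (simp add: expectation_bind_pmf_finite)

lemma Hoeffding_lemma_pmf:
  fixes g :: "'a \<Rightarrow> real"
  assumes fin: "finite (set_pmf q)" and diff: "\<And>x y. x \<in> set_pmf q \<Longrightarrow> y \<in> set_pmf q \<Longrightarrow> g x - g y \<le> c"
    and s: "s > 0"
  shows "measure_pmf.expectation q (\<lambda>x. exp (s * (g x - measure_pmf.expectation q g))) \<le> exp (s\<^sup>2 * c\<^sup>2 / 8)"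
proof -
  \<comment> \<open>The minimum over the finite support turns the bound on differences into an
    interval of length \<open>c\<close>.\<close>
  define a where "a = Min (g ` set_pmf q)"
  have "a \<in> g ` set_pmf q" unfolding a_def using fin set_pmf_not_empty[of q] by (intro Min_in) auto
  then obtain y where y: "y \<in> set_pmf q" "a = g y" by auto
  have "g x \<in> {a..a + c}" if "x \<in> set_pmf q" for x
  proof -
    have "a \<le> g x" unfolding a_def using that fin by (intro Min_le) auto
    then show ?thesis using diff[OF that y(1)] y(2) by simp
  qed
  then interpret interval_bounded_random_variable "measure_pmf q" g a "a + c"
    by unfold_locales (auto simp: AE_measure_pmf_iff)
  have "ennreal (measure_pmf.expectation q (\<lambda>x. exp (s * (g x - measure_pmf.expectation q g))))
      = (\<integral>\<^sup>+x. ennreal (exp (s * (g x - measure_pmf.expectation q g))) \<partial>measure_pmf q)"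
    using fin by (intro nn_integral_eq_integral[symmetric] integrable_measure_pmf_finite) auto
  also have "\<dots> \<le> ennreal (exp (s\<^sup>2 * c\<^sup>2 / 8))"
    using Hoeffdings_lemma_nn_integral[OF s] by simp
  finally show ?thesis by (simp add: ennreal_le_iff)
qed

text \<open>Induction on the first point: with \<open>g x\<close> the conditional mean, the
  deviation splits into \<open>f (x # xs) - g x\<close>, handled by the induction hypothesis, and
  \<open>g x - e\<close>, handled by Hoeffding's lemma because \<open>g\<close> inherits the
  difference bound.\<close>

lemma bounded_differences_mgf:
  fixes f :: "'a list \<Rightarrow> real"
  assumes fin: "finite (set_pmf q)" and s: "s > 0"
    and diff: "\<And>xs x y ys. Suc (length xs + length ys) = m \<Longrightarrow> set xs \<union> set ys \<union> {x, y} \<subseteq> set_pmf q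
       \<Longrightarrow> f (xs @ x # ys) - f (xs @ y # ys) \<le> c"
  shows "measure_pmf.expectation (replicate_pmf m q)
      (\<lambda>xs. exp (s * (f xs - measure_pmf.expectation (replicate_pmf m q) f))) \<le> exp (real m * (s\<^sup>2 * c\<^sup>2 / 8))"
  using diff
proof (induction m arbitrary: f)
  case 0
  then show ?case by simp
next
  case (Suc m)
  let ?E = "measure_pmf.expectation q" and ?Em = "measure_pmf.expectation (replicate_pmf m q)"
  note finm = finite_set_replicate_pmf[OF fin, of m]
  define g where "g x = ?Em (\<lambda>xs. f (x # xs))" for x
  define e where "e = ?E g"
  have Ef: "measure_pmf.expectation (replicate_pmf (Suc m) q) f = e"
    unfolding expectation_replicate_pmf_Suc[OF fin] by (simp add: e_def g_def[abs_def])
  have inner: "?Em (\<lambda>xs. exp (s * (f (x # xs) - g x))) \<le> exp (real m * (s\<^sup>2 * c\<^sup>2 / 8))"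
    if "x \<in> set_pmf q" for x
    unfolding g_def
  proof (rule Suc.IH)
    fix xs y z ys
    assume "Suc (length xs + length ys) = m" "set xs \<union> set ys \<union> {y, z} \<subseteq> set_pmf q"
    then show "f (x # xs @ y # ys) - f (x # xs @ z # ys) \<le> c"
      using Suc.prems[of "x # xs" ys y z] that by simp
  qed
  have "g x - g y \<le> c" if "x \<in> set_pmf q" "y \<in> set_pmf q" for x y
  proof -
    have "g x \<le> ?Em (\<lambda>xs. f (y # xs) + c)"
      unfolding g_def
    proof (rule expectation_pmf_mono[OF finm])
      fix xs assume "xs \<in> set_pmf (replicate_pmf m q)"
      then have "set xs \<subseteq> set_pmf q" "length xs = m" by (auto simp: set_replicate_pmf)
      then show "f (x # xs) \<le> f (y # xs) + c"
        using Suc.prems[of "[]" xs x y] that by simp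
    qed
    also have "\<dots> = g y + c" unfolding g_def by (subst expectation_pmf_add[OF finm]) simp
    finally show ?thesis by simp
  qed
  then have outer: "?E (\<lambda>x. exp (s * (g x - e))) \<le> exp (s\<^sup>2 * c\<^sup>2 / 8)"
    unfolding e_def by (intro Hoeffding_lemma_pmf fin s)
  have "measure_pmf.expectation (replicate_pmf (Suc m) q) (\<lambda>xs. exp (s * (f xs - e)))
      = ?E (\<lambda>x. exp (s * (g x - e)) * ?Em (\<lambda>xs. exp (s * (f (x # xs) - g x))))"
    unfolding expectation_replicate_pmf_Suc[OF fin]
    by (simp add: algebra_simps flip: exp_add integral_mult_right_zero)
  also have "\<dots> \<le> ?E (\<lambda>x. exp (s * (g x - e)) * exp (real m * (s\<^sup>2 * c\<^sup>2 / 8)))"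
    by (intro expectation_pmf_mono[OF fin] mult_left_mono inner) auto
  also have "\<dots> = ?E (\<lambda>x. exp (s * (g x - e))) * exp (real m * (s\<^sup>2 * c\<^sup>2 / 8))" by simp
  also have "\<dots> \<le> exp (s\<^sup>2 * c\<^sup>2 / 8) * exp (real m * (s\<^sup>2 * c\<^sup>2 / 8))"
    by (intro mult_right_mono outer) auto
  also have "\<dots> = exp (real (Suc m) * (s\<^sup>2 * c\<^sup>2 / 8))"
    by (simp add: algebra_simps add_divide_distrib flip: exp_add)
  finally show ?case unfolding Ef .
qed

theorem McDiarmid_ineq:
  fixes f :: "'a list \<Rightarrow> real"
  assumes fin: "finite (set_pmf q)" and m: "m > 0" and c: "c > 0" and u: "u > 0"
    and diff: "\<And>xs x y ys. Suc (length xs + length ys) = m \<Longrightarrow> set xs \<union> set ys \<union> {x, y} \<subseteq> set_pmf q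
       \<Longrightarrow> f (xs @ x # ys) - f (xs @ y # ys) \<le> c"
  shows "measure_pmf.prob (replicate_pmf m q) {xs. f xs > measure_pmf.expectation (replicate_pmf m q) f + u}
     \<le> exp (- (2 * u\<^sup>2 / (real m * c\<^sup>2)))"
proof -
  define e where "e = measure_pmf.expectation (replicate_pmf m q) f"
  \<comment> \<open>This Chernoff parameter minimizes
    \<open>- (s * u) + real m * (s\<^sup>2 * c\<^sup>2 / 8)\<close>.\<close>
  define s where "s = 4 * u / (real m * c\<^sup>2)"
  have s: "s > 0" using m c u by (simp add: s_def)
  note finm = finite_set_replicate_pmf[OF fin, of m]
  have "measure_pmf.prob (replicate_pmf m q) {xs. f xs > e + u}
     = measure_pmf.expectation (replicate_pmf m q) (indicator {xs. f xs > e + u})" by simp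
  also have "\<dots> \<le> measure_pmf.expectation (replicate_pmf m q) (\<lambda>xs. exp (- (s * u)) * exp (s * (f xs - e)))"
  proof (rule expectation_pmf_mono[OF finm])
    fix xs
    have "1 \<le> exp (- (s * u) + s * (f xs - e))" if "f xs > e + u"
    proof -
      have "s * u \<le> s * (f xs - e)" using s that by (intro mult_left_mono) auto
      then show ?thesis by simp
    qed
    then show "indicator {xs. f xs > e + u} xs \<le> exp (- (s * u)) * exp (s * (f xs - e))"
      by (auto simp: indicator_def simp flip: exp_add)
  qed
  also have "\<dots> = exp (- (s * u)) * measure_pmf.expectation (replicate_pmf m q) (\<lambda>xs. exp (s * (f xs - e)))"
    by simp
  also have "\<dots> \<le> exp (- (s * u)) * exp (real m * (s\<^sup>2 * c\<^sup>2 / 8))"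
    unfolding e_def by (intro mult_left_mono bounded_differences_mgf fin s diff) auto
  also have "\<dots> = exp (- (s * u) + real m * (s\<^sup>2 * c\<^sup>2 / 8))" by (simp only: exp_add)
  also have "- (s * u) + real m * (s\<^sup>2 * c\<^sup>2 / 8) = - (2 * u\<^sup>2 / (real m * c\<^sup>2))"
    using m c by (simp add: s_def field_simps power2_eq_square)
  finally show ?thesis by (simp add: e_def)
qed

section \<open>Symmetrization and contraction\<close>

lemma cSUP_add_le:
  fixes a b :: "'g \<Rightarrow> real"
  assumes "X \<noteq> {}" "\<And>g h. g \<in> X \<Longrightarrow> h \<in> X \<Longrightarrow> a g + b h \<le> R"
  shows "(SUP g\<in>X. a g) + (SUP g\<in>X. b g) \<le> R"
proof -
  have "(SUP g\<in>X. a g) \<le> R - b h" if "h \<in> X" for h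
    using assms that by (intro cSUP_least) (auto simp: le_diff_eq)
  then have "(SUP g\<in>X. b g) \<le> R - (SUP g\<in>X. a g)"
    using assms(1) by (intro cSUP_least) (auto simp: algebra_simps)
  then show ?thesis by simp
qed

text \<open>The two suprema are compared on pairs \<open>g\<close>, \<open>h\<close>. The Lipschitz
  bound gives \<open>L * \<bar>x g - x h\<bar>\<close>, and the sign of \<open>x g - x h\<close>
  decides which of the two takes the plus sign on the right.\<close>

lemma SUP_contraction:
  fixes u x :: "'g \<Rightarrow> real"
  assumes X: "X \<noteq> {}" and bdd: "bdd_above ((\<lambda>g. u g + L * x g) ` X)" "bdd_above ((\<lambda>g. u g - L * x g) ` X)"
    and lip: "\<And>r s. \<bar>\<phi> r - \<phi> s\<bar> \<le> L * \<bar>r - s\<bar>"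
  shows "(SUP g\<in>X. u g + \<phi> (x g)) + (SUP g\<in>X. u g - \<phi> (x g))
     \<le> (SUP g\<in>X. u g + L * x g) + (SUP g\<in>X. u g - L * x g)"
proof (rule cSUP_add_le[OF X])
  fix g h assume gh: "g \<in> X" "h \<in> X"
  have up: "u g + L * x g \<le> (SUP g\<in>X. u g + L * x g)" "u g - L * x g \<le> (SUP g\<in>X. u g - L * x g)"
    if "g \<in> X" for g
    by (rule cSUP_upper[OF that bdd(1)], rule cSUP_upper[OF that bdd(2)])
  show "u g + \<phi> (x g) + (u h - \<phi> (x h)) \<le> (SUP g\<in>X. u g + L * x g) + (SUP g\<in>X. u g - L * x g)"
  proof (cases "x g \<ge> x h")
    case True
    then have "\<phi> (x g) - \<phi> (x h) \<le> L * x g - L * x h"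
      using lip[of "x g" "x h"] by (simp add: right_diff_distrib)
    then show ?thesis using up(1)[OF gh(1)] up(2)[OF gh(2)] by linarith
  next
    case False
    then have "\<phi> (x g) - \<phi> (x h) \<le> L * x h - L * x g"
      using lip[of "x g" "x h"] by (simp add: right_diff_distrib)
    then show ?thesis using up(2)[OF gh(1)] up(1)[OF gh(2)] by linarith
  qed
qed

text \<open>The summand is the mean of \<open>u g + 2 * E (h g)\<close> and
  \<open>u g - 2 * h g z\<close>; in the first half the supremum of an expectation is at most the
  expectation of the supremum. The sign is thereby symmetrized at a single point
  \<open>z\<close>.\<close>

lemma expectation_SUP_symmetrization:
  fixes u :: "'g \<Rightarrow> real" and h :: "'g \<Rightarrow> 'z \<Rightarrow> real"
  assumes fin: "finite (set_pmf q)" and X: "X \<noteq> {}"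
    and bdd: "\<And>z. z \<in> set_pmf q \<Longrightarrow> bdd_above ((\<lambda>g. u g + 2 * h g z) ` X)"
      "\<And>z. z \<in> set_pmf q \<Longrightarrow> bdd_above ((\<lambda>g. u g - 2 * h g z) ` X)"
  shows "measure_pmf.expectation q (\<lambda>z. SUP g\<in>X. u g + (measure_pmf.expectation q (h g) - h g z))
     \<le> measure_pmf.expectation q (\<lambda>z. ((SUP g\<in>X. u g + 2 * h g z) + (SUP g\<in>X. u g - 2 * h g z)) / 2)"
proof -
  define a where "a z = (SUP g\<in>X. u g + 2 * h g z)" for z
  define b where "b z = (SUP g\<in>X. u g - 2 * h g z)" for z
  let ?E = "measure_pmf.expectation q"
  have "?E (\<lambda>z. SUP g\<in>X. u g + (?E (h g) - h g z)) \<le> ?E (\<lambda>z. ?E a / 2 + b z / 2)"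
  proof (intro expectation_pmf_mono[OF fin] cSUP_least[OF X])
    fix z g assume z: "z \<in> set_pmf q" and g: "g \<in> X"
    have "u g + 2 * ?E (h g) = ?E (\<lambda>z. u g + 2 * h g z)"
      by (subst expectation_pmf_add[OF fin]) simp
    also have "\<dots> \<le> ?E a"
      unfolding a_def by (intro expectation_pmf_mono[OF fin] cSUP_upper[OF g] bdd)
    finally have "u g + 2 * ?E (h g) \<le> ?E a" .
    moreover have "u g - 2 * h g z \<le> b z" unfolding b_def by (intro cSUP_upper[OF g] bdd z)
    ultimately show "u g + (?E (h g) - h g z) \<le> ?E a / 2 + b z / 2" by simp
  qed
  also have "\<dots> = ?E (\<lambda>z. (a z + b z) / 2)"
    by (simp add: expectation_pmf_add[OF fin])
  finally show ?thesis by (simp add: a_def b_def)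
qed

section \<open>The distribution of one observation\<close>

lemma expectation_pair_dist:
  fixes p :: "('n::{finite,linorder}) triple \<Rightarrow> real" and f :: "'n triple \<times> real \<Rightarrow> real"
  assumes n3: "CARD('n) \<ge> 3" and p01: "\<forall>t\<in>triples. 0 \<le> p t \<and> p t \<le> 1"
  shows "measure_pmf.expectation (pair_dist p) f
    = (\<Sum>t\<in>triples. p t * f (t, -1) + (1 - p t) * f (t, 1)) / real (card (triples :: 'n triple set))"
proof -
  note ne = triples_nonempty[OF n3]
  have "measure_pmf.expectation (pair_dist p) f = measure_pmf.expectation (pmf_of_set triples)
     (\<lambda>t. measure_pmf.expectation (bernoulli_pmf (p t)) (\<lambda>b. f (t, if b then -1 else 1)))"
    unfolding pair_dist_def using ne by (subst expectation_bind_pmf_finite)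
      (auto simp: expectation_bind_pmf_finite intro: finite_subset[OF subset_UNIV])
  also have "\<dots> = (\<Sum>t\<in>triples. measure_pmf.expectation (bernoulli_pmf (p t)) (\<lambda>b. f (t, if b then -1 else 1)))
      / real (card (triples :: 'n triple set))"
    using ne by (simp add: integral_pmf_of_set)
  also have "(\<Sum>t\<in>triples. measure_pmf.expectation (bernoulli_pmf (p t)) (\<lambda>b. f (t, if b then -1 else 1)))
     = (\<Sum>t\<in>triples. p t * f (t, -1) + (1 - p t) * f (t, 1))"
    using p01 by (intro sum.cong refl) simp
  finally show ?thesis .
qed

lemma set_pair_dist_subset:
  fixes p :: "('n::{finite,linorder}) triple \<Rightarrow> real"
  assumes "CARD('n) \<ge> 3"
  shows "set_pmf (pair_dist p) \<subseteq> triples \<times> {-1, 1}"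
  using triples_nonempty[OF assms] by (auto simp: pair_dist_def)

section \<open>Boundedness over the feasible set\<close>

lemma Gset_entry_le:
  assumes "G \<in> Gset lam gam"
  shows "\<bar>G $ a $ b\<bar> \<le> gam"
proof -
  have "{\<bar>G $ a $ b\<bar> |a b. True} = (\<lambda>(a, b). \<bar>G $ a $ b\<bar>) ` UNIV" by auto
  then have "finite {\<bar>G $ a $ b\<bar> |a b. True}" by simp
  then have "\<bar>G $ a $ b\<bar> \<le> max_norm G" unfolding max_norm_def by (intro Max_ge) auto
  then show ?thesis using assms by (simp add: Gset_def)
qed

text \<open>The inner product is a combination of six entries of \<open>G\<close> with coefficients
  1 or -1.\<close>

lemma frob_inner_Lmat_le:
  fixes G :: "real^('n::{finite,linorder})^('n::{finite,linorder})"
  assumes G: "G \<in> Gset lam gam" and t: "t \<in> triples"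
  shows "\<bar>frob_inner (Lmat t) G\<bar> \<le> 6 * gam"
proof -
  obtain i j k where ijk [simp]: "t = (i, j, k)" by (cases t)
  show ?thesis
    using Gset_entry_le[OF G, of k i] Gset_entry_le[OF G, of j i] Gset_entry_le[OF G, of j j]
      Gset_entry_le[OF G, of i j] Gset_entry_le[OF G, of i k] Gset_entry_le[OF G, of k k]
      trace_Lmat_mult[OF triplesD[OF t[unfolded ijk]], of G]
    by (simp add: frob_inner_def)
qed

text \<open>Ensures that suprema over \<open>Gset\<close> are genuine upper bounds, as real
  \<open>SUP\<close> presupposes a bounded set.\<close>

lemma bounded_frob_inner: "bounded (frob_inner A ` Gset lam gam)"
proof (rule boundedI)
  fix y assume "y \<in> frob_inner A ` Gset lam gam"
  then obtain G where G: "G \<in> Gset lam gam" "y = frob_inner A G" by auto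
  have "\<bar>y\<bar> \<le> (\<Sum>i\<in>UNIV. \<Sum>j\<in>UNIV. \<bar>A $ i $ j * G $ j $ i\<bar>)"
    unfolding G frob_inner_def trace_mult_nth by (intro order_trans[OF sum_abs] sum_mono sum_abs)
  also have "\<dots> \<le> (\<Sum>i\<in>UNIV. \<Sum>j\<in>UNIV. \<bar>A $ i $ j\<bar> * gam)"
    unfolding abs_mult by (intro sum_mono mult_left_mono Gset_entry_le[OF G(1)]) auto
  finally show "norm y \<le> (\<Sum>i\<in>UNIV. \<Sum>j\<in>UNIV. \<bar>A $ i $ j\<bar> * gam)" by simp
qed

lemma frob_inner_add: "frob_inner (A + B) G = frob_inner A G + frob_inner B (G :: real^'n^'n)"
  by (simp add: frob_inner_def matrix_add_rdistrib trace_add)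

lemma frob_inner_diff: "frob_inner (A - B) G = frob_inner A G - frob_inner B (G :: real^'n^'n)"
  by (simp add: frob_inner_def matrix_diff_rdistrib trace_sub)

lemma bounded_cmult_comp:
  fixes f :: "'g \<Rightarrow> real"
  assumes "bounded (f ` X)"
  shows "bounded ((\<lambda>g. c * f g) ` X)"
  using bounded_scaling[OF assms, of c] by (simp add: image_image)

lemma bounded_sum_list_comp:
  fixes f :: "'g \<Rightarrow> 'z \<Rightarrow> real"
  assumes "\<And>z. z \<in> set S \<Longrightarrow> bounded ((\<lambda>g. f g z) ` X)"
  shows "bounded ((\<lambda>g. sum_list (map (f g) S)) ` X)"
  using assms
proof (induction S)
  case Nil
  have "(\<lambda>g. 0::real) ` X \<subseteq> {0}" by auto
  then show ?case using bounded_subset[of "{0::real}"] by simp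
next
  case (Cons z S)
  then show ?case by (simp add: bounded_plus_comp)
qed

text \<open>Each step trades one sample point for a Rademacher-signed \<open>L\<^sub>t\<close>, absorbed into \<open>A\<close>.\<close>
lemma expectation_SUP_le_log_trace_mexp:
  fixes l :: "real \<Rightarrow> real" and p :: "('n::{finite,linorder}) triple \<Rightarrow> real"
    and Gstar A :: "real^('n::{finite,linorder})^('n::{finite,linorder})"
    and h :: "real^('n::{finite,linorder})^('n::{finite,linorder}) \<Rightarrow> 'n triple \<times> real \<Rightarrow> real"
  assumes n3: "CARD('n) \<ge> 3" and lip: "L-lipschitz_on UNIV l"
    and p01: "\<forall>t\<in>triples. 0 \<le> p t \<and> p t \<le> 1"
    and Gstar: "Gstar \<in> Gset lam gam" and \<theta>: "\<theta> > 0" "\<theta>\<^sup>2 \<le> 3 / 4"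
    and h: "\<And>G t y. h G (t, y) = l (y * frob_inner (Lmat t) G) - r (t, y)"
    and hbdd: "\<And>G z. G \<in> Gset lam gam \<Longrightarrow> z \<in> set_pmf (pair_dist p) \<Longrightarrow> \<bar>h G z\<bar> \<le> K"
    and A: "transpose A = A" "trace A = 0" and lam: "lam > 0"
  shows "measure_pmf.expectation (sample_dist m p) (\<lambda>S. SUP G\<in>Gset lam gam. 2 * L * frob_inner A G
      + sum_list (map (\<lambda>z. measure_pmf.expectation (pair_dist p) (h G) - h G z) S))
    \<le> 2 * L * lam * ((ln (trace (mexp (\<theta> *\<^sub>R A))) + real m * (9 * \<theta>\<^sup>2 / real CARD('n))) / \<theta>)"
  using A
proof (induction m arbitrary: A)
  case 0
  have L0: "L \<ge> 0" using lip by (rule lipschitz_on_nonneg)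
  have "(SUP G\<in>Gset lam gam. 2 * L * frob_inner A G) \<le> 2 * L * lam * (ln (trace (mexp (\<theta> *\<^sub>R A))) / \<theta>)"
  proof (rule cSUP_least)
    fix G :: "real^('n::{finite,linorder})^('n::{finite,linorder})"
    assume "G \<in> Gset lam gam"
    then have "psd G" "trace G \<le> lam" by (auto simp: Gset_def nuclear_norm_psd)
    then have "2 * L * frob_inner A G \<le> 2 * L * (lam * (ln (trace (mexp (\<theta> *\<^sub>R A))) / \<theta>))"
      using L0 by (intro mult_left_mono frob_inner_le_log_trace_mexp 0 \<theta>) auto
    then show "2 * L * frob_inner A G \<le> 2 * L * lam * (ln (trace (mexp (\<theta> *\<^sub>R A))) / \<theta>)" by simp
  qed (use Gstar in auto)
  then show ?case by (simp add: sample_dist_def)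
next
  case (Suc m)
  define X :: "(real^('n::{finite,linorder})^('n::{finite,linorder})) set" where "X = Gset lam gam"
  define q where "q = pair_dist p"
  define \<mu> where "\<mu> G = measure_pmf.expectation q (h G)" for G
  define w where "w G S = sum_list (map (\<lambda>z. \<mu> G - h G z) S)" for G S
  define N where "N = real (card (triples :: 'n triple set))"
  define \<kappa> where "\<kappa> = 9 * \<theta>\<^sup>2 / real CARD('n)"
  define T where "T B = ln (trace (mexp (\<theta> *\<^sub>R B)))" for B :: "real^('n::{finite,linorder})^('n::{finite,linorder})"
  \<comment> \<open>\<open>F B S\<close> is the supremum once the signed matrices are collected in
    \<open>B\<close> and the sample points \<open>S\<close> remain; \<open>T\<close> is the
    potential and \<open>\<kappa>\<close> bounds its mean growth per step.\<close>
  define F where "F B S = (SUP G\<in>X. 2 * L * frob_inner B G + w G S)" for B S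
  let ?E = "measure_pmf.expectation q" and ?Em = "measure_pmf.expectation (replicate_pmf m q)"
  have L0: "L \<ge> 0" using lip by (rule lipschitz_on_nonneg)
  have X: "X \<noteq> {}" using Gstar by (auto simp: X_def)
  have qsub: "set_pmf q \<subseteq> triples \<times> {-1, 1}" unfolding q_def by (rule set_pair_dist_subset[OF n3])
  have fin: "finite (set_pmf q)" by (rule finite_subset[OF qsub]) simp
  note finm = finite_set_replicate_pmf[OF fin, of m]
  have N: "N > 0" using triples_nonempty[OF n3] by (simp add: N_def card_gt_0_iff)
  have IH: "?Em (F B) \<le> 2 * L * lam * ((T B + real m * \<kappa>) / \<theta>)"
    if "transpose B = B" "trace B = 0" for B
    using Suc.IH[OF that] by (simp add: F_def[abs_def] X_def q_def \<mu>_def w_def T_def \<kappa>_def sample_dist_def)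
  have bfrob: "bounded ((\<lambda>G. c * frob_inner B G) ` X)" for c B
    unfolding X_def by (intro bounded_cmult_comp) (rule bounded_frob_inner)
  have bh: "bounded ((\<lambda>G. h G z) ` X)" if "z \<in> set_pmf q" for z
    using hbdd[OF _ that[unfolded q_def]] by (intro boundedI[of _ K]) (auto simp: X_def)
  have b\<mu>: "bounded (\<mu> ` X)"
  proof (rule boundedI[of _ K])
    fix y assume "y \<in> \<mu> ` X"
    then obtain G where G: "G \<in> Gset lam gam" "y = \<mu> G" by (auto simp: X_def)
    have "\<mu> G \<le> ?E (\<lambda>_. K)" "?E (\<lambda>_. - K) \<le> \<mu> G" unfolding \<mu>_def
      using hbdd[OF G(1)] by (intro expectation_pmf_mono[OF fin]; force simp: q_def abs_le_iff)+
    then show "norm y \<le> K" by (simp add: G abs_le_iff)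
  qed
  have bw: "bounded ((\<lambda>G. w G S) ` X)" if "set S \<subseteq> set_pmf q" for S
    unfolding w_def using that by (intro bounded_sum_list_comp bounded_minus_comp b\<mu> bh) auto
  have step: "?E (\<lambda>z. F A (z # S)) \<le> (\<Sum>t\<in>triples. (F (A + Lmat t) S + F (A - Lmat t) S) / 2) / N"
    if S: "set S \<subseteq> set_pmf q" for S
  proof -
    define u where "u G = 2 * L * frob_inner A G + w G S" for G
    have bu: "bounded (u ` X)" unfolding u_def[abs_def] by (intro bounded_plus_comp bfrob bw S)
    have plus: "(SUP G\<in>X. u G + 2 * L * frob_inner (Lmat t) G) = F (A + Lmat t) S"
      and minus: "(SUP G\<in>X. u G - 2 * L * frob_inner (Lmat t) G) = F (A - Lmat t) S" for t
      by (simp_all add: F_def u_def frob_inner_add frob_inner_diff algebra_simps)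
    have "?E (\<lambda>z. F A (z # S)) = ?E (\<lambda>z. SUP G\<in>X. u G + (?E (h G) - h G z))"
      by (simp add: F_def u_def w_def \<mu>_def algebra_simps)
    also have "\<dots> \<le> ?E (\<lambda>z. ((SUP G\<in>X. u G + 2 * h G z) + (SUP G\<in>X. u G - 2 * h G z)) / 2)"
      by (intro expectation_SUP_symmetrization fin X bounded_imp_bdd_above bounded_plus_comp
          bounded_minus_comp bounded_cmult_comp bu bh)
    also have "\<dots> \<le> ?E (\<lambda>z. (F (A + Lmat (fst z)) S + F (A - Lmat (fst z)) S) / 2)"
    proof (intro expectation_pmf_mono[OF fin] divide_right_mono)
      fix z assume "z \<in> set_pmf q"
      then obtain t y where z: "z = (t, y)" and y: "\<bar>y\<bar> = 1" using qsub by (cases z) auto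
      \<comment> \<open>Since \<open>\<bar>y\<bar> = 1\<close>, the label is absorbed into a
        \<open>2 * L\<close>-Lipschitz function of the inner product, and contraction removes both
        loss and label.\<close>
      define \<phi> where "\<phi> x = 2 * (l (y * x) - r (t, y))" for x
      have "\<bar>\<phi> a - \<phi> b\<bar> \<le> 2 * L * \<bar>a - b\<bar>" for a b
      proof -
        have "\<bar>l (y * a) - l (y * b)\<bar> \<le> L * \<bar>y * a - y * b\<bar>"
          using lipschitz_onD[OF lip, of "y * a" "y * b"] by (simp add: dist_real_def)
        also have "\<bar>y * a - y * b\<bar> = \<bar>a - b\<bar>"
          using y by (simp add: right_diff_distrib[symmetric] abs_mult)
        finally show ?thesis by (simp add: \<phi>_def)
      qed
      then have "(SUP G\<in>X. u G + \<phi> (frob_inner (Lmat t) G)) + (SUP G\<in>X. u G - \<phi> (frob_inner (Lmat t) G))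
         \<le> (SUP G\<in>X. u G + 2 * L * frob_inner (Lmat t) G) + (SUP G\<in>X. u G - 2 * L * frob_inner (Lmat t) G)"
        by (intro SUP_contraction X bounded_imp_bdd_above bounded_plus_comp bounded_minus_comp bu bfrob)
      then show "(SUP G\<in>X. u G + 2 * h G z) + (SUP G\<in>X. u G - 2 * h G z)
         \<le> F (A + Lmat (fst z)) S + F (A - Lmat (fst z)) S"
        unfolding plus minus by (simp add: z h \<phi>_def)
    qed simp
    \<comment> \<open>The integrand depends on the triple only, so the weights \<open>p t\<close>
      and \<open>1 - p t\<close> add up and leave a uniform average.\<close>
    also have "\<dots> = (\<Sum>t\<in>triples. (F (A + Lmat t) S + F (A - Lmat t) S) / 2) / N"
      unfolding q_def expectation_pair_dist[OF n3 p01] N_def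
      by (simp add: algebra_simps add_divide_distrib[symmetric])
    finally show ?thesis .
  qed
  have "measure_pmf.expectation (sample_dist (Suc m) p) (F A) = ?Em (\<lambda>S. ?E (\<lambda>z. F A (z # S)))"
    unfolding sample_dist_def q_def[symmetric] by (rule expectation_replicate_pmf_Suc'[OF fin])
  also have "\<dots> \<le> ?Em (\<lambda>S. (\<Sum>t\<in>triples. (F (A + Lmat t) S + F (A - Lmat t) S) / 2) / N)"
    by (intro expectation_pmf_mono[OF finm] step) (auto simp: set_replicate_pmf)
  also have "\<dots> = (\<Sum>t\<in>triples. (?Em (F (A + Lmat t)) + ?Em (F (A - Lmat t))) / 2) / N"
    by (simp add: Bochner_Integration.integral_sum integrable_measure_pmf_finite[OF finm]
        expectation_pmf_add[OF finm])
  also have "\<dots> \<le> (\<Sum>t\<in>triples. (2 * L * lam * ((T (A + Lmat t) + real m * \<kappa>) / \<theta>)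
       + 2 * L * lam * ((T (A - Lmat t) + real m * \<kappa>) / \<theta>)) / 2) / N"
  proof (intro divide_right_mono sum_mono add_mono IH)
    fix t :: "'n triple" assume "t \<in> triples"
    then have "trace (Lmat t) = 0" by (cases t) (auto intro: trace_Lmat dest: triplesD)
    then show "trace (A + Lmat t) = 0" "trace (A - Lmat t) = 0"
      using Suc.prems by (simp_all add: trace_add trace_sub)
    show "transpose (A + Lmat t) = A + Lmat t" "transpose (A - Lmat t) = A - Lmat t"
      using Suc.prems by (simp_all add: transpose_add transpose_minus transpose_Lmat
          diff_conv_add_uminus del: add_uminus_conv_diff)
  qed (use N in auto)
  also have "\<dots> = L * lam / \<theta> / N * ((\<Sum>t\<in>triples. T (A + Lmat t) + T (A - Lmat t)) + 2 * N * (real m * \<kappa>))"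
  proof -
    have "(2 * L * lam * ((T (A + Lmat t) + real m * \<kappa>) / \<theta>) + 2 * L * lam * ((T (A - Lmat t) + real m * \<kappa>) / \<theta>)) / 2
       = L * lam / \<theta> * ((T (A + Lmat t) + T (A - Lmat t)) + 2 * (real m * \<kappa>))" for t
      using \<theta> by (simp add: field_simps)
    then have "(\<Sum>t\<in>triples. (2 * L * lam * ((T (A + Lmat t) + real m * \<kappa>) / \<theta>)
         + 2 * L * lam * ((T (A - Lmat t) + real m * \<kappa>) / \<theta>)) / 2)
       = L * lam / \<theta> * (\<Sum>t\<in>triples. (T (A + Lmat t) + T (A - Lmat t)) + 2 * (real m * \<kappa>))"
      by (simp add: sum_distrib_left)
    also have "(\<Sum>t\<in>triples. (T (A + Lmat t) + T (A - Lmat t)) + 2 * (real m * \<kappa>))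
       = (\<Sum>t\<in>triples. T (A + Lmat t) + T (A - Lmat t)) + 2 * N * (real m * \<kappa>)"
      by (subst sum.distrib) (simp add: N_def)
    finally show ?thesis by simp
  qed
  also have "\<dots> \<le> L * lam / \<theta> / N * (2 * N * (T A + \<kappa>) + 2 * N * (real m * \<kappa>))"
    using sum_log_trace_mexp_step[OF Suc.prems(1) \<theta>(2)] L0 lam \<theta> N
    by (intro mult_left_mono add_right_mono) (auto simp: T_def \<kappa>_def N_def)
  also have "\<dots> = 2 * L * lam * ((T A + real (Suc m) * \<kappa>) / \<theta>)"
    using N \<theta> by (simp add: field_simps)
  finally show ?case by (simp add: F_def[abs_def] X_def q_def \<mu>_def w_def T_def \<kappa>_def)
qed

section \<open>Choice of \<theta> and the excess risk bound\<close>

text \<open>The unconstrained minimizer of \<open>a / \<theta> + v * \<theta>\<close> is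
  \<open>sqrt (a / v)\<close>, with value \<open>2 * sqrt (v * a)\<close>. If it is too large, the
  endpoint \<open>sqrt 3 / 2\<close> turns \<open>a / \<theta>\<close> into the linear term, and
  \<open>v < 4 * a / 3\<close> controls the rest.\<close>

lemma Bernstein_parameter:
  fixes a v :: real
  assumes a: "a > 0" and v: "v > 0"
  obtains \<theta> where "\<theta> > 0" "\<theta>\<^sup>2 \<le> 3 / 4" "(a + v * \<theta>\<^sup>2) / \<theta> \<le> 2 * (sqrt (2 * v * a) + sqrt 3 / 3 * a)"
proof (cases "a / v \<le> 3 / 4")
  case True
  define \<theta> where "\<theta> = sqrt (a / v)"
  have \<theta>: "\<theta> > 0" "\<theta>\<^sup>2 = a / v" using a v by (auto simp: \<theta>_def)
  have "(a + v * \<theta>\<^sup>2) / \<theta> = 2 * a / \<theta>" using \<theta> v by simp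
  also have "\<dots> = 2 * sqrt (v * a)"
    using a v by (simp add: \<theta>_def real_sqrt_divide real_sqrt_mult field_simps)
  also have "\<dots> \<le> 2 * sqrt (2 * v * a)" using a v by simp
  also have "\<dots> \<le> 2 * (sqrt (2 * v * a) + sqrt 3 / 3 * a)" using a by simp
  finally show ?thesis using that \<theta> True by simp
next
  case False
  define \<theta> where "\<theta> = sqrt 3 / 2"
  have \<theta>: "\<theta> > 0" "\<theta>\<^sup>2 = 3 / 4" by (auto simp: \<theta>_def power_divide)
  have "v\<^sup>2 \<le> (4 * a / 3) * v" using False a v by (simp add: field_simps power2_eq_square)
  then have "(v * \<theta>)\<^sup>2 \<le> v * a" unfolding power_mult_distrib \<theta> by (simp add: mult_ac)
  then have "v * \<theta> \<le> sqrt (v * a)" by (rule real_le_rsqrt)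
  also have "\<dots> \<le> 2 * sqrt (2 * v * a)"
  proof -
    have "sqrt (v * a) \<le> sqrt (2 * v * a)" "0 \<le> sqrt (2 * v * a)" using a v by simp_all
    then show ?thesis by linarith
  qed
  finally have "v * \<theta> \<le> 2 * sqrt (2 * v * a)" .
  moreover have "a / \<theta> = 2 * (sqrt 3 / 3 * a)"
    by (simp add: \<theta>_def field_simps)
  moreover have "(a + v * \<theta>\<^sup>2) / \<theta> = a / \<theta> + v * \<theta>" using \<theta> by (simp add: field_simps power2_eq_square)
  ultimately show ?thesis using that[of \<theta>] \<theta> by simp
qed

text \<open>The accumulated matrix starts at zero, so the initial potential is
  \<open>ln n\<close>.\<close>

lemma trace_mexp_0: "trace (mexp (0 :: real^'n^'n)) = real CARD('n)"
proof -
  have "spectral (mat 1) (\<lambda>_. 0) (0 :: real^'n^'n)"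
    by (simp add: spectral_def orthogonal_matrix_id diag_mat_def zero_vec_def[symmetric] vec_eq_iff)
  then show ?thesis by (subst trace_spectral[OF spectral_mexp]) auto
qed


theorem theorem1:
  fixes l :: "real \<Rightarrow> real" and L lam gam \<delta> :: real and m :: nat
    and p :: "('n::{finite,linorder}) triple \<Rightarrow> real"
    and Gstar :: "real^('n::{finite,linorder})^('n::{finite,linorder})"
    and Ghat :: "(('n::{finite,linorder}) triple \<times> real) list \<Rightarrow> real^('n::{finite,linorder})^('n::{finite,linorder})"
  assumes n3: "CARD('n::{finite,linorder}) \<ge> 3"
    and lam: "lam > 0" and gam: "gam > 0"
    and delta: "0 < \<delta>" "\<delta> < 1"
    and lip: "L-lipschitz_on UNIV l"
    and p01: "\<forall>t\<in>triples. 0 \<le> p t \<and> p t \<le> 1"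
    and m: "m > 0"
    and Gstar: "Gstar \<in> Gset lam gam"
    and Ghat: "\<forall>S\<in>set_pmf (sample_dist m p).
                 Ghat S \<in> Gset lam gam \<and> (\<forall>G\<in>Gset lam gam. emp_risk l S (Ghat S) \<le> emp_risk l S G)"
  shows "measure_pmf.prob (sample_dist m p)
           {S. risk l p (Ghat S) - risk l p Gstar
               \<le> 4 * L * lam / real m *
                   (sqrt (18 * real m * ln (real CARD('n::{finite,linorder})) / real CARD('n::{finite,linorder}))
                    + sqrt 3 / 3 * ln (real CARD('n::{finite,linorder})))
                 + L * gam * sqrt (288 * ln (2 / \<delta>) / real m)}
         \<ge> 1 - \<delta>"
proof (cases "L = 0")
  case True
  \<comment> \<open>A constant loss makes all risks equal. This case is separate because McDiarmid's
    inequality is applied with the positive difference bound \<open>24 * L * gam\<close>.\<close>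
  have "l x = l y" for x y using lipschitz_onD[OF lip, of x y] True by simp
  then have "risk l p G = risk l p Gstar" for G
    unfolding risk_def Let_def by (intro arg_cong2[of _ _ _ _ "(*)"] refl sum.cong arg_cong2[of _ _ _ _ "(+)"]) auto
  then have "risk l p (Ghat S) - risk l p Gstar = 0" for S by simp
  then show ?thesis using True delta by simp
next
  case False
  have L: "L > 0" using lipschitz_on_nonneg[OF lip] False by simp
  define X :: "(real^('n::{finite,linorder})^('n::{finite,linorder})) set" where "X = Gset lam gam"
  define q where "q = pair_dist p"
  \<comment> \<open>Subtracting the loss of \<open>Gstar\<close> makes the summands bounded through
    the Lipschitz condition alone and turns their mean into the excess risk.\<close>
  define r where "r z = l (snd z * frob_inner (Lmat (fst z)) Gstar)" for z
  define h where "h G z = l (snd z * frob_inner (Lmat (fst z)) G) - r z" for G z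
  define \<mu> where "\<mu> G = measure_pmf.expectation q (h G)" for G
  define \<Phi> where "\<Phi> S = (SUP G\<in>X. sum_list (map (\<lambda>z. \<mu> G - h G z) S))" for S
  define e where "e = measure_pmf.expectation (replicate_pmf m q) \<Phi>"
  define n where "n = real CARD('n)"
  define b where "b = sqrt (18 * real m * ln n / n) + sqrt 3 / 3 * ln n"
  define u where "u = real m * (L * gam * sqrt (288 * ln (2 / \<delta>) / real m))"
  have X: "X \<noteq> {}" using Gstar by (auto simp: X_def)
  have qsub: "set_pmf q \<subseteq> triples \<times> {-1, 1}" unfolding q_def by (rule set_pair_dist_subset[OF n3])
  have fin: "finite (set_pmf q)" by (rule finite_subset[OF qsub]) simp
  have n: "n \<ge> 3" using n3 by (simp add: n_def)
  have hbdd: "\<bar>h G z\<bar> \<le> 12 * L * gam" if G: "G \<in> X" and z: "z \<in> set_pmf q" for G z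
  proof -
    obtain t y where ty: "z = (t, y)" "t \<in> triples" "\<bar>y\<bar> = 1" using qsub z by (cases z) auto
    have "\<bar>h G z\<bar> \<le> L * \<bar>y * frob_inner (Lmat t) G - y * frob_inner (Lmat t) Gstar\<bar>"
      using lipschitz_onD[OF lip, of "y * frob_inner (Lmat t) G" "y * frob_inner (Lmat t) Gstar"]
      by (simp add: h_def r_def ty dist_real_def)
    also have "\<bar>y * frob_inner (Lmat t) G - y * frob_inner (Lmat t) Gstar\<bar>
        = \<bar>frob_inner (Lmat t) G - frob_inner (Lmat t) Gstar\<bar>"
      using ty by (simp add: right_diff_distrib[symmetric] abs_mult)
    also have "\<dots> \<le> 12 * gam"
      using frob_inner_Lmat_le[OF G[unfolded X_def] ty(2)] frob_inner_Lmat_le[OF Gstar ty(2)] by simp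
    finally show ?thesis using L by simp
  qed
  have \<mu>: "\<mu> G = risk l p G - risk l p Gstar" for G
  proof -
    have "\<mu> G = (\<Sum>t\<in>triples. (p t * l (- frob_inner (Lmat t) G) + (1 - p t) * l (frob_inner (Lmat t) G))
       - (p t * l (- frob_inner (Lmat t) Gstar) + (1 - p t) * l (frob_inner (Lmat t) Gstar)))
         / real (card (triples :: 'n triple set))"
      unfolding \<mu>_def q_def expectation_pair_dist[OF n3 p01] h_def r_def by (simp add: algebra_simps)
    then show ?thesis by (simp add: risk_def sum_subtractf diff_divide_distrib)
  qed
  have \<mu>bdd: "\<bar>\<mu> G\<bar> \<le> 12 * L * gam" if "G \<in> X" for G
  proof -
    have "\<mu> G \<le> measure_pmf.expectation q (\<lambda>_. 12 * L * gam)"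
      "measure_pmf.expectation q (\<lambda>_. - (12 * L * gam)) \<le> \<mu> G"
      unfolding \<mu>_def using hbdd[OF that] by (intro expectation_pmf_mono[OF fin]; force simp: abs_le_iff)+
    then show ?thesis by (simp add: abs_le_iff)
  qed
  have bdd: "bdd_above ((\<lambda>G. sum_list (map (\<lambda>z. \<mu> G - h G z) S)) ` X)" if "set S \<subseteq> set_pmf q" for S
  proof (intro bounded_imp_bdd_above bounded_sum_list_comp bounded_minus_comp)
    show "bounded (\<mu> ` X)" using \<mu>bdd by (intro boundedI) auto
    show "bounded ((\<lambda>G. h G z) ` X)" if "z \<in> set S" for z
      using hbdd[OF _ subsetD[OF \<open>set S \<subseteq> set_pmf q\<close> that]] by (intro boundedI) auto
  qed

  have "e \<le> 4 * L * lam * b"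
  proof -
    \<comment> \<open>\<open>ln n\<close> is the initial potential, and
      \<open>9 * real m / n\<close> collects the growth \<open>9 * \<theta>\<^sup>2 / n\<close> of
      the \<open>m\<close> steps.\<close>
    obtain \<theta> where \<theta>: "\<theta> > 0" "\<theta>\<^sup>2 \<le> 3 / 4"
      and le: "(ln n + 9 * real m / n * \<theta>\<^sup>2) / \<theta> \<le> 2 * (sqrt (2 * (9 * real m / n) * ln n) + sqrt 3 / 3 * ln n)"
      using Bernstein_parameter[of "ln n" "9 * real m / n"] n m by auto
    have "frob_inner 0 G = 0" for G :: "real^('n::{finite,linorder})^('n::{finite,linorder})"
      by (simp add: frob_inner_def trace_def)
    moreover have "transpose (0 :: real^('n::{finite,linorder})^('n::{finite,linorder})) = 0"
      "trace (0 :: real^('n::{finite,linorder})^('n::{finite,linorder})) = 0"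
      by (simp_all add: transpose_def trace_def vec_eq_iff)
    ultimately have "e \<le> 2 * L * lam * ((ln n + real m * (9 * \<theta>\<^sup>2 / n)) / \<theta>)"
      using expectation_SUP_le_log_trace_mexp[OF n3 lip p01 Gstar \<theta>, where h = h and r = r
          and K = "12 * L * gam" and A = 0 and m = m, OF _ hbdd[unfolded X_def q_def] _ _ lam]
      by (simp add: e_def \<Phi>_def[abs_def] X_def q_def \<mu>_def n_def h_def sample_dist_def trace_mexp_0)
    also have "\<dots> = 2 * L * lam * ((ln n + 9 * real m / n * \<theta>\<^sup>2) / \<theta>)" by simp
    also have "\<dots> \<le> 2 * L * lam * (2 * (sqrt (2 * (9 * real m / n) * ln n) + sqrt 3 / 3 * ln n))"
      using L lam by (intro mult_left_mono le) auto
    also have "\<dots> = 4 * L * lam * b" by (simp add: b_def)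
    finally show ?thesis .
  qed

  have "measure_pmf.prob (replicate_pmf m q) {S. \<Phi> S > e + u} \<le> exp (- (2 * u\<^sup>2 / (real m * (24 * L * gam)\<^sup>2)))"
    unfolding e_def
  proof (rule McDiarmid_ineq[OF fin m])
    show "24 * L * gam > 0" using L gam by simp
    show "u > 0" using L gam m delta by (auto simp: u_def)
    fix xs x y ys
    assume sub: "set xs \<union> set ys \<union> {x, y} \<subseteq> set_pmf q"
    \<comment> \<open>Exchanging one point changes each sum by \<open>h G y - h G x\<close>, hence
      by at most twice the bound on \<open>h\<close>.\<close>
    have "\<Phi> (xs @ x # ys) \<le> \<Phi> (xs @ y # ys) + 24 * L * gam"
      unfolding \<Phi>_def
    proof (rule cSUP_least[OF X])
      fix G assume G: "G \<in> X"
      have "sum_list (map (\<lambda>z. \<mu> G - h G z) (xs @ x # ys))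
          = sum_list (map (\<lambda>z. \<mu> G - h G z) (xs @ y # ys)) + (h G y - h G x)" by simp
      also have "\<dots> \<le> (SUP G\<in>X. sum_list (map (\<lambda>z. \<mu> G - h G z) (xs @ y # ys))) + 24 * L * gam"
        using hbdd[OF G, of x] hbdd[OF G, of y] sub by (intro add_mono cSUP_upper[OF G] bdd) auto
      finally show "sum_list (map (\<lambda>z. \<mu> G - h G z) (xs @ x # ys))
          \<le> (SUP G\<in>X. sum_list (map (\<lambda>z. \<mu> G - h G z) (xs @ y # ys))) + 24 * L * gam" .
    qed
    then show "\<Phi> (xs @ x # ys) - \<Phi> (xs @ y # ys) \<le> 24 * L * gam" by simp
  qed
  \<comment> \<open>The constant 288 is half of 24^2, so the exponent is exactly
    \<open>ln (2 / \<delta>)\<close>.\<close>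
  also have "2 * u\<^sup>2 / (real m * (24 * L * gam)\<^sup>2) = ln (2 / \<delta>)"
  proof -
    have "(sqrt (288 * ln (2 / \<delta>) / real m))\<^sup>2 = 288 * ln (2 / \<delta>) / real m"
      using delta m by (intro real_sqrt_pow2) auto
    then have "u\<^sup>2 = (real m)\<^sup>2 * (L\<^sup>2 * gam\<^sup>2 * (288 * ln (2 / \<delta>) / real m))"
      by (simp add: u_def power_mult_distrib)
    then show ?thesis using m L gam by (simp add: field_simps power2_eq_square)
  qed
  also have "exp (- ln (2 / \<delta>)) = \<delta> / 2" using delta by (simp add: exp_minus)
  finally have conc: "measure_pmf.prob (replicate_pmf m q) {S. \<Phi> S > e + u} \<le> \<delta> / 2" .

  define good where "good = {S. risk l p (Ghat S) - risk l p Gstar \<le> 4 * L * lam / real m * b + u / real m}"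
  have good: "S \<in> good" if S: "S \<in> set_pmf (sample_dist m p)" and le: "\<Phi> S \<le> e + u" for S
  proof -
    have Sq: "set S \<subseteq> set_pmf q" and len: "length S = m"
      using S by (auto simp: sample_dist_def q_def set_replicate_pmf)
    have GX: "Ghat S \<in> X" and emp: "emp_risk l S (Ghat S) \<le> emp_risk l S Gstar"
      using Ghat S Gstar by (auto simp: X_def)
    \<comment> \<open>Empirical minimality makes this sum nonpositive, so \<open>real m\<close>
      times the excess risk is at most the centred sum at \<open>Ghat S\<close>, which
      \<open>\<Phi> S\<close> dominates.\<close>
    have "sum_list (map (h (Ghat S)) S) = real m * (emp_risk l S (Ghat S) - emp_risk l S Gstar)"
      using m by (simp add: emp_risk_def len h_def[abs_def] r_def case_prod_unfold sum_list_subtractf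
          right_diff_distrib)
    also have "\<dots> \<le> 0" using emp by (simp add: mult_nonneg_nonpos)
    finally have "real m * \<mu> (Ghat S) \<le> sum_list (map (\<lambda>z. \<mu> (Ghat S) - h (Ghat S) z) S)"
      by (simp add: sum_list_subtractf sum_list_triv len)
    also have "\<dots> \<le> \<Phi> S" unfolding \<Phi>_def by (rule cSUP_upper[OF GX bdd[OF Sq]])
    also have "\<dots> \<le> 4 * L * lam * b + u" using le \<open>e \<le> 4 * L * lam * b\<close> by simp
    finally have "\<mu> (Ghat S) \<le> (4 * L * lam * b + u) / real m" using m by (simp add: field_simps)
    then show ?thesis by (simp add: good_def \<mu> add_divide_distrib)
  qed
  have "measure_pmf.prob (sample_dist m p) (- good) \<le> measure_pmf.prob (sample_dist m p) {S. \<Phi> S > e + u}"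
    using good by (intro measure_pmf.finite_measure_mono_AE) (auto simp: AE_measure_pmf_iff not_le[symmetric])
  also have "\<dots> \<le> \<delta>" using conc delta by (simp add: sample_dist_def q_def)
  finally have "1 - \<delta> \<le> measure_pmf.prob (sample_dist m p) good"
    using measure_pmf.prob_compl[of good "sample_dist m p"] by (simp add: Compl_eq_Diff_UNIV)
  moreover have "u / real m = L * gam * sqrt (288 * ln (2 / \<delta>) / real m)" using m by (simp add: u_def)
  ultimately show ?thesis by (simp add: good_def b_def n_def)
qed

end
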